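(* Let $n\ge2$, $\mathbf b=(b_1,\dots,b_{n-2})\in\mathbb C^{n-2}$, and let $sl_n^{(\mathbf b)}$ be the Lie subalgebra of $sl_n(\mathbb C)$ generated by $u_i:=e_i+b_{i-1}f_{i-1}$, $i=1,\dots,n-1$ (with the convention $b_0=0$, $f_0=0$). Then the Lie algebra $sl_n^{(\mathbf b)}$ has a presentation with generators $u_1,\dots,u_{n-1}$ and relations: $\bullet$ $[u_i,u_j]=0$ if $|i-j|>1$; $\bullet$ $[u_i,[u_i,u_j]]=-2b_{\min(i,j)}u_i$ if $|i-j|=1$.
   Context: $e_i=E_{i,i+1}$, $f_i=E_{i+1,i}$ ($1\le i\le n-1$) are the standard Chevalley generators of $sl_n$. *)

theory Defs
  imports
    Complex_Main
    "HOL-Algebra.QuotRing"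
    "HOL-Library.Poly_Mapping"
    "Jordan_Normal_Form.VS_Connect"
begin

section \<open>Lie algebras with explicit carriers\<close>

text \<open>
  As for the library's locale \<open>algebra\<close>, an algebra is a \<^typ>\<open>('k, 'a) module\<close> record whose
  \<open>mult\<close> field is its product; for a Lie algebra \<open>x \<otimes> y\<close> is the bracket \<open>[x, y]\<close>.
  There is no unit: the field \<open>one\<close> of the record is never used.
\<close>

locale nonassoc_algebra = VectorSpace.vectorspace K A for K (structure) and A (structure) +
  assumes prod_closed:
      "\<lbrakk>x \<in> carrier A; y \<in> carrier A\<rbrakk> \<Longrightarrow> x \<otimes>\<^bsub>A\<^esub> y \<in> carrier A"
    and prod_add_left:
      "\<lbrakk>x \<in> carrier A; y \<in> carrier A; z \<in> carrier A\<rbrakk>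
        \<Longrightarrow> (x \<oplus>\<^bsub>A\<^esub> y) \<otimes>\<^bsub>A\<^esub> z = x \<otimes>\<^bsub>A\<^esub> z \<oplus>\<^bsub>A\<^esub> y \<otimes>\<^bsub>A\<^esub> z"
    and prod_add_right:
      "\<lbrakk>x \<in> carrier A; y \<in> carrier A; z \<in> carrier A\<rbrakk>
        \<Longrightarrow> z \<otimes>\<^bsub>A\<^esub> (x \<oplus>\<^bsub>A\<^esub> y) = z \<otimes>\<^bsub>A\<^esub> x \<oplus>\<^bsub>A\<^esub> z \<otimes>\<^bsub>A\<^esub> y"
    and prod_smult_left:
      "\<lbrakk>c \<in> carrier K; x \<in> carrier A; y \<in> carrier A\<rbrakk>
        \<Longrightarrow> (c \<odot>\<^bsub>A\<^esub> x) \<otimes>\<^bsub>A\<^esub> y = c \<odot>\<^bsub>A\<^esub> (x \<otimes>\<^bsub>A\<^esub> y)"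
    and prod_smult_right:
      "\<lbrakk>c \<in> carrier K; x \<in> carrier A; y \<in> carrier A\<rbrakk>
        \<Longrightarrow> x \<otimes>\<^bsub>A\<^esub> (c \<odot>\<^bsub>A\<^esub> y) = c \<odot>\<^bsub>A\<^esub> (x \<otimes>\<^bsub>A\<^esub> y)"

locale lie_algebra = nonassoc_algebra K L for K (structure) and L (structure) +
  assumes bracket_self:
      "x \<in> carrier L \<Longrightarrow> x \<otimes>\<^bsub>L\<^esub> x = \<zero>\<^bsub>L\<^esub>"
    and jacobi:
      "\<lbrakk>x \<in> carrier L; y \<in> carrier L; z \<in> carrier L\<rbrakk>
        \<Longrightarrow> x \<otimes>\<^bsub>L\<^esub> (y \<otimes>\<^bsub>L\<^esub> z) \<oplus>\<^bsub>L\<^esub> y \<otimes>\<^bsub>L\<^esub> (z \<otimes>\<^bsub>L\<^esub> x) \<oplus>\<^bsub>L\<^esub> z \<otimes>\<^bsub>L\<^esub> (x \<otimes>\<^bsub>L\<^esub> y) = \<zero>\<^bsub>L\<^esub>"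

definition subalgebra :: "'k ring \<Rightarrow> 'a set \<Rightarrow> ('k, 'a) module \<Rightarrow> bool" where
  "subalgebra K H A \<longleftrightarrow>
     VectorSpace.subspace K H A \<and> (\<forall>x\<in>H. \<forall>y\<in>H. x \<otimes>\<^bsub>A\<^esub> y \<in> H)"

definition generated_subalgebra :: "'k ring \<Rightarrow> ('k, 'a) module \<Rightarrow> 'a set \<Rightarrow> 'a set" where
  "generated_subalgebra K A S = \<Inter>{H. subalgebra K H A \<and> S \<subseteq> H}"

definition algebra_ideal :: "'k ring \<Rightarrow> 'a set \<Rightarrow> ('k, 'a) module \<Rightarrow> bool" where
  "algebra_ideal K I A \<longleftrightarrow>
     VectorSpace.subspace K I A \<and> (\<forall>x\<in>I. \<forall>a\<in>carrier A. a \<otimes>\<^bsub>A\<^esub> x \<in> I \<and> x \<otimes>\<^bsub>A\<^esub> a \<in> I)"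

definition generated_ideal :: "'k ring \<Rightarrow> ('k, 'a) module \<Rightarrow> 'a set \<Rightarrow> 'a set" where
  "generated_ideal K A S = \<Inter>{I. algebra_ideal K I A \<and> S \<subseteq> I}"

text \<open>The analogue of \<^const>\<open>FactRing\<close> for algebras: the elements are the cosets of \<open>I\<close>.\<close>

definition quotient_algebra :: "('k, 'a) module \<Rightarrow> 'a set \<Rightarrow> ('k, 'a set) module" where
  "quotient_algebra A I =
     \<lparr>carrier = a_rcosets\<^bsub>A\<^esub> I, mult = rcoset_mult A I, one = I, zero = I, add = set_add A,
      smult = (\<lambda>c C. \<Union>x\<in>C. I +>\<^bsub>A\<^esub> (c \<odot>\<^bsub>A\<^esub> x))\<rparr>"

definition algebra_iso :: "'k ring \<Rightarrow> ('k, 'a) module \<Rightarrow> ('k, 'b) module \<Rightarrow> ('a \<Rightarrow> 'b) set" where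
  "algebra_iso K A B =
     {f \<in> LinearCombinations.module_hom K A B. (\<forall>x\<in>carrier A. \<forall>y\<in>carrier A. f (x \<otimes>\<^bsub>A\<^esub> y) = f x \<otimes>\<^bsub>B\<^esub> f y)
        \<and> bij_betw f (carrier A) (carrier B)}"


section \<open>Free Lie algebras and presentations\<close>

datatype 'x magma = Gen 'x | Prod "'x magma" "'x magma"

text \<open>
  The free nonassociative algebra on \<open>X\<close> over the field \<^typ>\<open>'k\<close>: the formal linear combinations
  of nonassociative words in letters from \<open>X\<close>.  The product of two words is \<^const>\<open>Prod\<close>,
  extended bilinearly.
\<close>

definition free_nonassoc :: "'x set \<Rightarrow> ('k::field, 'x magma \<Rightarrow>\<^sub>0 'k) module" where
  "free_nonassoc X =
     \<lparr>carrier = {p. \<forall>w\<in>Poly_Mapping.keys p. set_magma w \<subseteq> X},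
      mult = (\<lambda>p q. \<Sum>v\<in>Poly_Mapping.keys p. \<Sum>w\<in>Poly_Mapping.keys q.
         Poly_Mapping.single (Prod v w) (Poly_Mapping.lookup p v * Poly_Mapping.lookup q w)),
      one = 0, zero = 0, add = (+),
      smult = (\<lambda>c. Poly_Mapping.map ((*) c))\<rparr>"

definition lie_axiom_relators :: "('k, 'a) module \<Rightarrow> 'a set" where
  "lie_axiom_relators A =
     {x \<otimes>\<^bsub>A\<^esub> x | x. x \<in> carrier A} \<union>
     {x \<otimes>\<^bsub>A\<^esub> (y \<otimes>\<^bsub>A\<^esub> z) \<oplus>\<^bsub>A\<^esub> y \<otimes>\<^bsub>A\<^esub> (z \<otimes>\<^bsub>A\<^esub> x) \<oplus>\<^bsub>A\<^esub> z \<otimes>\<^bsub>A\<^esub> (x \<otimes>\<^bsub>A\<^esub> y) | x y z.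
        x \<in> carrier A \<and> y \<in> carrier A \<and> z \<in> carrier A}"

definition lie_axiom_ideal :: "'x set \<Rightarrow> ('x magma \<Rightarrow>\<^sub>0 'k::field) set" where
  "lie_axiom_ideal X =
     generated_ideal class_ring (free_nonassoc X) (lie_axiom_relators (free_nonassoc X))"

definition free_lie :: "'x set \<Rightarrow> ('k::field, ('x magma \<Rightarrow>\<^sub>0 'k) set) module" where
  "free_lie X = quotient_algebra (free_nonassoc X) (lie_axiom_ideal X)"

definition free_lie_gen :: "'x set \<Rightarrow> 'x \<Rightarrow> ('x magma \<Rightarrow>\<^sub>0 'k::field) set" where
  "free_lie_gen X x = lie_axiom_ideal X +>\<^bsub>free_nonassoc X\<^esub> Poly_Mapping.single (Gen x) 1"

text \<open>A relation \<open>p = q\<close> between elements of the free Lie algebra is given as the pair \<open>(p, q)\<close>.\<close>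

type_synonym ('x, 'k) lie_relation = "('x magma \<Rightarrow>\<^sub>0 'k) set \<times> ('x magma \<Rightarrow>\<^sub>0 'k) set"

definition relation_ideal ::
    "'x set \<Rightarrow> ('x, 'k::field) lie_relation set \<Rightarrow> ('x magma \<Rightarrow>\<^sub>0 'k) set set" where
  "relation_ideal X Rel =
     generated_ideal class_ring (free_lie X) {p \<ominus>\<^bsub>free_lie X\<^esub> q | p q. (p, q) \<in> Rel}"

definition presented_lie ::
    "'x set \<Rightarrow> ('x, 'k::field) lie_relation set \<Rightarrow> ('k, ('x magma \<Rightarrow>\<^sub>0 'k) set set) module" where
  "presented_lie X Rel = quotient_algebra (free_lie X) (relation_ideal X Rel)"

definition presented_gen ::
    "'x set \<Rightarrow> ('x, 'k::field) lie_relation set \<Rightarrow> 'x \<Rightarrow> ('x magma \<Rightarrow>\<^sub>0 'k) set set" where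
  "presented_gen X Rel x = relation_ideal X Rel +>\<^bsub>free_lie X\<^esub> free_lie_gen X x"

text \<open>\<open>L\<close> is presented by the generators \<open>u x\<close> (\<open>x \<in> X\<close>) and the relations \<open>Rel\<close>.\<close>

definition has_lie_presentation ::
    "('k::field, 'a) module \<Rightarrow> 'x set \<Rightarrow> ('x \<Rightarrow> 'a) \<Rightarrow> ('x, 'k) lie_relation set \<Rightarrow> bool" where
  "has_lie_presentation L X u Rel \<longleftrightarrow>
     lie_algebra class_ring L \<and> u \<in> X \<rightarrow> carrier L \<and>
     (\<exists>\<phi>\<in>algebra_iso class_ring (presented_lie X Rel) L. \<forall>x\<in>X. \<phi> (presented_gen X Rel x) = u x)"


section \<open>The subalgebras \<open>sl\<^sub>n\<^sup>(\<^sup>b\<^sup>)\<close> of \<open>sl\<^sub>n\<close>\<close>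

definition sl :: "nat \<Rightarrow> (complex, complex mat) module" where
  "sl n =
     \<lparr>carrier = {A \<in> carrier_mat n n. (\<Sum>i<n. A $$ (i, i)) = 0},
      mult = (\<lambda>A B. A * B - B * A), one = 0\<^sub>m n n, zero = 0\<^sub>m n n, add = (+), smult = (\<cdot>\<^sub>m)\<rparr>"

text \<open>Rows and columns are counted from 1, whereas the library counts them from 0.\<close>

definition matrix_unit :: "nat \<Rightarrow> nat \<Rightarrow> nat \<Rightarrow> complex mat" where
  "matrix_unit n i j = mat n n (\<lambda>(r, c). if r + 1 = i \<and> c + 1 = j then 1 else 0)"

definition chevalley_e :: "nat \<Rightarrow> nat \<Rightarrow> complex mat" where
  "chevalley_e n i = matrix_unit n i (i + 1)"

definition chevalley_f :: "nat \<Rightarrow> nat \<Rightarrow> complex mat" where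
  "chevalley_f n i = matrix_unit n (i + 1) i"

text \<open>
  The vector \<open>(b\<^sub>1, \<dots>, b\<^bsub>n-2\<^esub>)\<close> is a function of which only the values at \<open>1, \<dots>, n - 2\<close> matter.
  In particular \<open>chevalley_f n 0 = 0\<close> (there is no column 0), so the term
  \<open>b\<^sub>0 f\<^sub>0\<close> of \<open>u\<^sub>1\<close> vanishes whatever \<open>b 0\<close> is.
\<close>

definition sl_b_gen :: "nat \<Rightarrow> (nat \<Rightarrow> complex) \<Rightarrow> nat \<Rightarrow> complex mat" where
  "sl_b_gen n b i = chevalley_e n i + b (i - 1) \<cdot>\<^sub>m chevalley_f n (i - 1)"

definition sl_b :: "nat \<Rightarrow> (nat \<Rightarrow> complex) \<Rightarrow> (complex, complex mat) module" where
  "sl_b n b = (sl n)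
     \<lparr>carrier := generated_subalgebra class_ring (sl n) (sl_b_gen n b ` {1..n-1})\<rparr>"

definition sl_b_relations :: "nat \<Rightarrow> (nat \<Rightarrow> complex) \<Rightarrow> (nat, complex) lie_relation set" where
  "sl_b_relations n b =
     (let F = free_lie {1..n-1}; x = free_lie_gen {1..n-1} in
      {(x i \<otimes>\<^bsub>F\<^esub> x j, \<zero>\<^bsub>F\<^esub>) | i j.
         i \<in> {1..n-1} \<and> j \<in> {1..n-1} \<and> \<bar>int i - int j\<bar> > 1} \<union>
      {(x i \<otimes>\<^bsub>F\<^esub> (x i \<otimes>\<^bsub>F\<^esub> x j), (- 2 * b (min i j)) \<odot>\<^bsub>F\<^esub> x i) | i j.
         i \<in> {1..n-1} \<and> j \<in> {1..n-1} \<and> \<bar>int i - int j\<bar> = 1})"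

end

(*
  In any Lie algebra satisfying the relations, the span of the brackets
  [x_i, [x_(i+1), ... [x_(j-1), x_j]]] with i <= j is stable under bracketing with each x_k: the
  relations are a deformation of the Serre relations of the positive part of sl_n, and the Jacobi
  identity expresses each such bracket by brackets of at most the expected length.  Hence these
  elements span the presented algebra.  In sl_n the corresponding iterated bracket of the u_i is
  E_(i,j+1) plus terms on lower diagonals, so the images of the spanning elements are linearly
  independent, and the surjection of the presented algebra onto the subalgebra is injective.
*)

theory Submission
  imports Defs
begin

section \<open>Homomorphisms, subalgebras and quotients\<close>

text \<open>For b = 0 the relations are homogeneous and the presented algebra is graded by positive
  roots. If some b_i is nonzero, the second kind of relation equates brackets of lengths 3 and 1, so
  only the filtration by length survives; brackets are therefore shown to lie in a span instead of
  being computed. The induction closes because bracketing with x_k, k > i, never moves the left end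
  of a spanning element below i. The critical case is k = i + 1, where an equation of the form z = t
  - z has to be solved. The constant in the relations comes from rank one: u_i is a unit column
  times a row, so u_i^2 = 0 and [u_i, [u_i, u_j]] = -2 u_i u_j u_i, which is a multiple of u_i. The
  pairs i <= j are as numerous as the matrix units above the diagonal, so each spanning element has
  a leading position of its own.\<close>

lemma subspaceI:
  assumes "vectorspace K V" "W \<subseteq> carrier V" "\<zero>\<^bsub>V\<^esub> \<in> W"
    and "\<And>x y. x \<in> W \<Longrightarrow> y \<in> W \<Longrightarrow> x \<oplus>\<^bsub>V\<^esub> y \<in> W"
    and "\<And>c x. c \<in> carrier K \<Longrightarrow> x \<in> W \<Longrightarrow> c \<odot>\<^bsub>V\<^esub> x \<in> W"
  shows "VectorSpace.subspace K W V"
proof -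
  interpret vectorspace K V by fact
  show ?thesis
    by (intro VectorSpace.subspace.intro LinearCombinations.submodule.intro assms module_axioms) auto
qed

lemma subspaceD:
  assumes "VectorSpace.subspace K W V"
  shows "W \<subseteq> carrier V" "\<zero>\<^bsub>V\<^esub> \<in> W"
    and "\<And>x y. x \<in> W \<Longrightarrow> y \<in> W \<Longrightarrow> x \<oplus>\<^bsub>V\<^esub> y \<in> W"
    and "\<And>c x. c \<in> carrier K \<Longrightarrow> x \<in> W \<Longrightarrow> c \<odot>\<^bsub>V\<^esub> x \<in> W"
    and "vectorspace K V"
  using assms by (auto simp: VectorSpace.subspace_def LinearCombinations.submodule_def)

lemma subspace_uminus:
  assumes "VectorSpace.subspace K W V" "x \<in> W"
  shows "\<ominus>\<^bsub>V\<^esub> x \<in> W"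
proof -
  note W = subspaceD[OF assms(1)]
  interpret vectorspace K V by (rule W(5))
  have "\<ominus>\<^bsub>V\<^esub> x = (\<ominus>\<^bsub>K\<^esub> \<one>\<^bsub>K\<^esub>) \<odot>\<^bsub>V\<^esub> x"
    using W(1) assms(2) by (auto simp: smult_l_minus)
  then show ?thesis using W(4) assms(2) by simp
qed

lemma subspace_minus:
  assumes "VectorSpace.subspace K W V" "x \<in> W" "y \<in> W"
  shows "x \<ominus>\<^bsub>V\<^esub> y \<in> W"
  unfolding a_minus_def using assms subspaceD(3) subspace_uminus by metis

lemma subspace_Inter:
  assumes "vectorspace K V" "\<And>H. H \<in> \<S> \<Longrightarrow> VectorSpace.subspace K H V" "\<S> \<noteq> {}"
  shows "VectorSpace.subspace K (\<Inter>\<S>) V"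
  using assms subspaceD[OF assms(2)] by (intro subspaceI) (simp_all, blast)

text \<open>\<open>generated_ideal\<close> is an intersection, and an empty intersection would be
  \<open>UNIV\<close>. The carrier, assumed to be an ideal, belongs to the family, so the
  intersection is again a subspace.\<close>

lemma algebra_ideal_generated_ideal:
  assumes "algebra_ideal K (carrier A) A" "S \<subseteq> carrier A"
  shows "algebra_ideal K (generated_ideal K A S) A" "S \<subseteq> generated_ideal K A S"
    and "\<And>I. algebra_ideal K I A \<Longrightarrow> S \<subseteq> I \<Longrightarrow> generated_ideal K A S \<subseteq> I"
proof -
  have "vectorspace K A"
    using assms(1) by (auto simp: algebra_ideal_def intro: subspaceD(5))
  then show "algebra_ideal K (generated_ideal K A S) A"
    using assms unfolding algebra_ideal_def generated_ideal_def
    by (intro conjI subspace_Inter) (auto simp: algebra_ideal_def)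
qed (auto simp: generated_ideal_def)

lemma subalgebra_generated_subalgebra:
  assumes "subalgebra K (carrier A) A" "S \<subseteq> carrier A"
  shows "subalgebra K (generated_subalgebra K A S) A" "S \<subseteq> generated_subalgebra K A S"
    and "\<And>H. subalgebra K H A \<Longrightarrow> S \<subseteq> H \<Longrightarrow> generated_subalgebra K A S \<subseteq> H"
proof -
  have "vectorspace K A"
    using assms(1) by (auto simp: subalgebra_def intro: subspaceD(5))
  then show "subalgebra K (generated_subalgebra K A S) A"
    using assms unfolding subalgebra_def generated_subalgebra_def
    by (intro conjI subspace_Inter) (auto simp: subalgebra_def)
qed (auto simp: generated_subalgebra_def)

section \<open>Algebra homomorphisms and transport of structure along surjections\<close>

definition algebra_hom :: "'k ring \<Rightarrow> ('k, 'a) module \<Rightarrow> ('k, 'b) module \<Rightarrow> ('a \<Rightarrow> 'b) set" where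
  "algebra_hom K A B =
     {f \<in> LinearCombinations.module_hom K A B.
        \<forall>x\<in>carrier A. \<forall>y\<in>carrier A. f (x \<otimes>\<^bsub>A\<^esub> y) = f x \<otimes>\<^bsub>B\<^esub> f y}"

lemma algebra_homI:
  assumes "\<And>x. x \<in> carrier A \<Longrightarrow> f x \<in> carrier B"
    and "\<And>x y. x \<in> carrier A \<Longrightarrow> y \<in> carrier A \<Longrightarrow> f (x \<oplus>\<^bsub>A\<^esub> y) = f x \<oplus>\<^bsub>B\<^esub> f y"
    and "\<And>c x. c \<in> carrier K \<Longrightarrow> x \<in> carrier A \<Longrightarrow> f (c \<odot>\<^bsub>A\<^esub> x) = c \<odot>\<^bsub>B\<^esub> f x"
    and "\<And>x y. x \<in> carrier A \<Longrightarrow> y \<in> carrier A \<Longrightarrow> f (x \<otimes>\<^bsub>A\<^esub> y) = f x \<otimes>\<^bsub>B\<^esub> f y"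
  shows "f \<in> algebra_hom K A B"
  using assms by (auto simp: algebra_hom_def LinearCombinations.module_hom_def)

lemma algebra_homD:
  assumes "f \<in> algebra_hom K A B"
  shows "\<And>x. x \<in> carrier A \<Longrightarrow> f x \<in> carrier B"
    and "\<And>x y. x \<in> carrier A \<Longrightarrow> y \<in> carrier A \<Longrightarrow> f (x \<oplus>\<^bsub>A\<^esub> y) = f x \<oplus>\<^bsub>B\<^esub> f y"
    and "\<And>c x. c \<in> carrier K \<Longrightarrow> x \<in> carrier A \<Longrightarrow> f (c \<odot>\<^bsub>A\<^esub> x) = c \<odot>\<^bsub>B\<^esub> f x"
    and "\<And>x y. x \<in> carrier A \<Longrightarrow> y \<in> carrier A \<Longrightarrow> f (x \<otimes>\<^bsub>A\<^esub> y) = f x \<otimes>\<^bsub>B\<^esub> f y"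
  using assms by (auto simp: algebra_hom_def LinearCombinations.module_hom_def)

lemma algebra_hom_zero:
  assumes "f \<in> algebra_hom K A B" "vectorspace K A" "vectorspace K B"
  shows "f \<zero>\<^bsub>A\<^esub> = \<zero>\<^bsub>B\<^esub>"
proof -
  interpret A: vectorspace K A by fact
  interpret B: vectorspace K B by fact
  have "f (\<zero>\<^bsub>K\<^esub> \<odot>\<^bsub>A\<^esub> \<zero>\<^bsub>A\<^esub>) = \<zero>\<^bsub>K\<^esub> \<odot>\<^bsub>B\<^esub> f \<zero>\<^bsub>A\<^esub>"
    by (intro algebra_homD[OF assms(1)]) auto
  then show ?thesis using algebra_homD(1)[OF assms(1)] by simp
qed

lemma algebra_hom_minus:
  assumes "f \<in> algebra_hom K A B" "vectorspace K A" "vectorspace K B"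
    and "x \<in> carrier A" "y \<in> carrier A"
  shows "f (x \<ominus>\<^bsub>A\<^esub> y) = f x \<ominus>\<^bsub>B\<^esub> f y"
proof -
  interpret A: vectorspace K A by fact
  interpret B: vectorspace K B by fact
  note f = algebra_homD[OF assms(1)]
  have "f (x \<oplus>\<^bsub>A\<^esub> (\<ominus>\<^bsub>K\<^esub> \<one>\<^bsub>K\<^esub>) \<odot>\<^bsub>A\<^esub> y) = f x \<oplus>\<^bsub>B\<^esub> (\<ominus>\<^bsub>K\<^esub> \<one>\<^bsub>K\<^esub>) \<odot>\<^bsub>B\<^esub> f y"
    using assms(4,5) by (simp add: f)
  then show ?thesis
    using assms(4,5) f(1) by (simp add: a_minus_def A.smult_l_minus B.smult_l_minus)
qed

lemma algebra_hom_compose: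
  assumes "f \<in> algebra_hom K A B" "g \<in> algebra_hom K B C"
  shows "(\<lambda>x. g (f x)) \<in> algebra_hom K A C"
  using algebra_homD[OF assms(1)] algebra_homD[OF assms(2)] by (intro algebra_homI) simp_all

text \<open>This is how quotients become algebras: nothing is known about the record
  \<open>B\<close> except that \<open>f\<close> maps onto it and respects the operations.
  Preservation of zero is a hypothesis because \<open>algebra_hom_zero\<close> would already require
  \<open>B\<close> to be a vector space.\<close>

lemma nonassoc_algebra_image:
  assumes "nonassoc_algebra K A" and f: "f \<in> algebra_hom K A B"
    and surj: "f ` carrier A = carrier B" and zero: "f \<zero>\<^bsub>A\<^esub> = \<zero>\<^bsub>B\<^esub>"
  shows "nonassoc_algebra K B"
proof -
  interpret A: nonassoc_algebra K A by fact
  note fD = algebra_homD[OF f]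
  note fR = fD(2-4)[symmetric]
  have add_cl: "x \<oplus>\<^bsub>B\<^esub> y \<in> carrier B" if "x \<in> carrier B" "y \<in> carrier B" for x y
    using that by (auto simp: fR simp flip: surj)
  have sm_cl: "c \<odot>\<^bsub>B\<^esub> x \<in> carrier B" if "c \<in> carrier K" "x \<in> carrier B" for c x
    using that by (auto simp: fR simp flip: surj)
  have "vectorspace K B"
  \<comment> \<open>With the zero of \<open>B\<close> written as an image, every element in the
    axioms is an image under \<open>f\<close>; \<open>fR\<close> pulls the operations inside
    \<open>f\<close>, where the axioms of \<open>A\<close> apply.\<close>
  proof (rule vs_criteria, unfold zero[symmetric])
    show "field K" by (rule A.field_axioms)
    show "f \<zero>\<^bsub>A\<^esub> \<in> carrier B" by (simp add: fD)
    show "\<forall>v\<in>carrier B. \<exists>w\<in>carrier B. v \<oplus>\<^bsub>B\<^esub> w = f \<zero>\<^bsub>A\<^esub>"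
    proof (intro ballI)
      fix v assume "v \<in> carrier B"
      then obtain a where a: "a \<in> carrier A" "v = f a" using surj by auto
      have "v \<oplus>\<^bsub>B\<^esub> f (\<ominus>\<^bsub>A\<^esub> a) = f \<zero>\<^bsub>A\<^esub>" using a by (simp add: fR A.r_neg)
      then show "\<exists>w\<in>carrier B. v \<oplus>\<^bsub>B\<^esub> w = f \<zero>\<^bsub>A\<^esub>" using a fD(1) by auto
    qed
  qed (auto simp: add_cl sm_cl fR A.M.a_ac A.smult_l_distr A.smult_r_distr A.smult_assoc1 simp flip: surj)
  then show ?thesis
    by (intro nonassoc_algebra.intro nonassoc_algebra_axioms.intro)
      (auto simp: fR A.prod_closed A.prod_add_left A.prod_add_right A.prod_smult_left
        A.prod_smult_right simp flip: surj)
qed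

lemma lie_algebra_image:
  assumes "lie_algebra K A" and f: "f \<in> algebra_hom K A B"
    and surj: "f ` carrier A = carrier B" and zero: "f \<zero>\<^bsub>A\<^esub> = \<zero>\<^bsub>B\<^esub>"
  shows "lie_algebra K B"
proof -
  interpret A: lie_algebra K A by fact
  note fR = algebra_homD(2-4)[OF f, symmetric]
  show ?thesis
    by (intro lie_algebra.intro lie_algebra_axioms.intro
        nonassoc_algebra_image[OF A.nonassoc_algebra_axioms f surj zero])
      (auto simp: fR A.prod_closed A.bracket_self A.jacobi zero simp flip: surj)
qed

lemma algebra_ideal_carrier:
  assumes "nonassoc_algebra K A"
  shows "algebra_ideal K (carrier A) A"
proof -
  interpret nonassoc_algebra K A by fact
  show ?thesis
    unfolding algebra_ideal_def
    by (auto intro!: subspaceI vectorspace_axioms simp: prod_closed)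
qed

lemma subalgebra_carrier:
  assumes "nonassoc_algebra K A"
  shows "subalgebra K (carrier A) A"
proof -
  interpret nonassoc_algebra K A by fact
  show ?thesis
    unfolding subalgebra_def
    by (auto intro!: subspaceI vectorspace_axioms simp: prod_closed)
qed

lemma nonassoc_algebra_subalgebra:
  assumes "nonassoc_algebra K A" "subalgebra K H A"
  shows "nonassoc_algebra K (A\<lparr>carrier := H\<rparr>)"
proof -
  interpret nonassoc_algebra K A by fact
  have H: "VectorSpace.subspace K H A" "\<And>x y. x \<in> H \<Longrightarrow> y \<in> H \<Longrightarrow> x \<otimes>\<^bsub>A\<^esub> y \<in> H"
    using assms by (auto simp: subalgebra_def)
  note sub = subsetD[OF subspaceD(1)[OF H(1)]]
  show ?thesis
    by (intro nonassoc_algebra.intro nonassoc_algebra_axioms.intro subspace_is_vs H(1))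
      (auto simp: H(2) sub prod_add_left prod_add_right prod_smult_left prod_smult_right)
qed

context nonassoc_algebra
begin

lemma prod_zero:
  assumes "x \<in> carrier A"
  shows "\<zero>\<^bsub>A\<^esub> \<otimes>\<^bsub>A\<^esub> x = \<zero>\<^bsub>A\<^esub>" "x \<otimes>\<^bsub>A\<^esub> \<zero>\<^bsub>A\<^esub> = \<zero>\<^bsub>A\<^esub>"
  using prod_smult_left[of "\<zero>\<^bsub>K\<^esub>" "\<zero>\<^bsub>A\<^esub>" x] prod_smult_right[of "\<zero>\<^bsub>K\<^esub>" x "\<zero>\<^bsub>A\<^esub>"] assms
    prod_closed by auto

lemma prod_uminus:
  assumes "x \<in> carrier A" "y \<in> carrier A"
  shows "(\<ominus>\<^bsub>A\<^esub> x) \<otimes>\<^bsub>A\<^esub> y = \<ominus>\<^bsub>A\<^esub> (x \<otimes>\<^bsub>A\<^esub> y)" "x \<otimes>\<^bsub>A\<^esub> (\<ominus>\<^bsub>A\<^esub> y) = \<ominus>\<^bsub>A\<^esub> (x \<otimes>\<^bsub>A\<^esub> y)"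
  using prod_smult_left[of "\<ominus>\<^bsub>K\<^esub> \<one>\<^bsub>K\<^esub>" x y] prod_smult_right[of "\<ominus>\<^bsub>K\<^esub> \<one>\<^bsub>K\<^esub>" x y] assms
    prod_closed by (auto simp: smult_l_minus)

end

section \<open>Quotients of algebras by two-sided ideals\<close>

locale algebra_with_ideal = nonassoc_algebra K A
  for K :: "'k ring" (structure) and A :: "('k, 'a) module" (structure) +
  fixes I
  assumes ideal: "algebra_ideal K I A"
begin

lemma ideal_subspace: "VectorSpace.subspace K I A"
  using ideal by (simp add: algebra_ideal_def)

text \<open>Gives access to the HOL-Algebra theory of additive cosets and their
  representatives.\<close>

lemma ideal_abelian_subgroup: "abelian_subgroup I A"
proof (intro abelian_subgroupI3 additive_subgroupI)
  show "subgroup I (add_monoid A)"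
    using subspaceD[OF ideal_subspace] subspace_uminus[OF ideal_subspace]
    by (intro M.add.subgroupI) (auto simp: a_inv_def)
qed (rule M.abelian_group_axioms)

sublocale I: abelian_subgroup I A by (rule ideal_abelian_subgroup)

lemma ideal_coset_eq_iff:
  assumes "x \<in> carrier A" "y \<in> carrier A"
  shows "I +>\<^bsub>A\<^esub> x = I +>\<^bsub>A\<^esub> y \<longleftrightarrow> x \<ominus>\<^bsub>A\<^esub> y \<in> I"
  using assms I.a_repr_independence' I.a_repr_independenceD I.a_rcos_module a_minus_def
  by metis

lemma coset_zero: "I +>\<^bsub>A\<^esub> \<zero>\<^bsub>A\<^esub> = I"
  using I.a_subset by (rule a_coset_add_zero)

lemma carrier_quotient_algebra: "carrier (quotient_algebra A I) = (\<lambda>x. I +>\<^bsub>A\<^esub> x) ` carrier A"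
  by (auto simp: quotient_algebra_def A_RCOSETS_def')

text \<open>The scalar multiple and the product of cosets are unions over all representatives. All
  members of such a union are the same coset because \<open>I\<close> is an ideal, so the union
  collapses to that coset.\<close>

lemma quotient_proj_hom: "(\<lambda>x. I +>\<^bsub>A\<^esub> x) \<in> algebra_hom K A (quotient_algebra A I)"
proof (intro algebra_homI)
  fix x assume x: "x \<in> carrier A"
  show "I +>\<^bsub>A\<^esub> x \<in> carrier (quotient_algebra A I)"
    using x by (simp add: carrier_quotient_algebra)
  {
    fix c assume c: "c \<in> carrier K"
    have "I +>\<^bsub>A\<^esub> (c \<odot>\<^bsub>A\<^esub> x') = I +>\<^bsub>A\<^esub> (c \<odot>\<^bsub>A\<^esub> x)" if "x' \<in> I +>\<^bsub>A\<^esub> x" for x'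
    proof -
      have x': "x' \<in> carrier A" using that x I.a_elemrcos_carrier by blast
      have "x' \<ominus>\<^bsub>A\<^esub> x \<in> I" using that x by (simp add: a_minus_def I.a_rcos_module_imp)
      then have "c \<odot>\<^bsub>A\<^esub> (x' \<ominus>\<^bsub>A\<^esub> x) \<in> I" using c subspaceD(4)[OF ideal_subspace] by blast
      also have "c \<odot>\<^bsub>A\<^esub> (x' \<ominus>\<^bsub>A\<^esub> x) = c \<odot>\<^bsub>A\<^esub> x' \<ominus>\<^bsub>A\<^esub> c \<odot>\<^bsub>A\<^esub> x"
        using c x x' by (simp add: a_minus_def smult_r_distr smult_r_minus)
      finally show ?thesis using c x x' ideal_coset_eq_iff by simp
    qed
    then have "(\<Union>x'\<in>I +>\<^bsub>A\<^esub> x. I +>\<^bsub>A\<^esub> (c \<odot>\<^bsub>A\<^esub> x')) = I +>\<^bsub>A\<^esub> (c \<odot>\<^bsub>A\<^esub> x)"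
      using I.a_rcos_self[OF x] by (intro SUP_eq_const) blast
    then show "I +>\<^bsub>A\<^esub> (c \<odot>\<^bsub>A\<^esub> x) = c \<odot>\<^bsub>quotient_algebra A I\<^esub> (I +>\<^bsub>A\<^esub> x)"
      by (simp add: quotient_algebra_def)
  }
  fix y assume y: "y \<in> carrier A"
  show "I +>\<^bsub>A\<^esub> (x \<oplus>\<^bsub>A\<^esub> y) = (I +>\<^bsub>A\<^esub> x) \<oplus>\<^bsub>quotient_algebra A I\<^esub> (I +>\<^bsub>A\<^esub> y)"
    using x y by (simp add: quotient_algebra_def I.a_rcos_sum)
  have "I +>\<^bsub>A\<^esub> (x' \<otimes>\<^bsub>A\<^esub> y') = I +>\<^bsub>A\<^esub> (x \<otimes>\<^bsub>A\<^esub> y)"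
    if "x' \<in> I +>\<^bsub>A\<^esub> x" "y' \<in> I +>\<^bsub>A\<^esub> y" for x' y'
  proof -
    have x': "x' \<in> carrier A" and y': "y' \<in> carrier A"
      using that x y I.a_elemrcos_carrier by blast+
    have "x' \<ominus>\<^bsub>A\<^esub> x \<in> I" "y' \<ominus>\<^bsub>A\<^esub> y \<in> I"
      using that x y by (simp_all add: a_minus_def I.a_rcos_module_imp)
    \<comment> \<open>Telescoping of x'y' - xy: the first term uses that \<open>I\<close> is a right
      ideal, the second that it is a left ideal.\<close>
    then have "(x' \<ominus>\<^bsub>A\<^esub> x) \<otimes>\<^bsub>A\<^esub> y' \<oplus>\<^bsub>A\<^esub> x \<otimes>\<^bsub>A\<^esub> (y' \<ominus>\<^bsub>A\<^esub> y) \<in> I"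
      using x y' ideal subspaceD(3)[OF ideal_subspace] by (simp add: algebra_ideal_def)
    also have "(x' \<ominus>\<^bsub>A\<^esub> x) \<otimes>\<^bsub>A\<^esub> y' \<oplus>\<^bsub>A\<^esub> x \<otimes>\<^bsub>A\<^esub> (y' \<ominus>\<^bsub>A\<^esub> y) = x' \<otimes>\<^bsub>A\<^esub> y' \<ominus>\<^bsub>A\<^esub> x \<otimes>\<^bsub>A\<^esub> y"
      using x y x' y'
      by (simp add: a_minus_def prod_add_left prod_add_right prod_uminus prod_closed M.a_assoc M.l_neg
          M.r_neg1 M.r_neg2)
    finally show ?thesis using x y x' y' prod_closed ideal_coset_eq_iff by simp
  qed
  then have "rcoset_mult A I (I +>\<^bsub>A\<^esub> x) (I +>\<^bsub>A\<^esub> y) = I +>\<^bsub>A\<^esub> (x \<otimes>\<^bsub>A\<^esub> y)"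
    unfolding rcoset_mult_def using I.a_rcos_self[OF x] I.a_rcos_self[OF y]
    by (intro SUP_eq_const) blast+
  then show "I +>\<^bsub>A\<^esub> (x \<otimes>\<^bsub>A\<^esub> y) = (I +>\<^bsub>A\<^esub> x) \<otimes>\<^bsub>quotient_algebra A I\<^esub> (I +>\<^bsub>A\<^esub> y)"
    by (simp add: quotient_algebra_def)
qed

lemma zero_quotient_algebra: "\<zero>\<^bsub>quotient_algebra A I\<^esub> = I"
  by (simp add: quotient_algebra_def)

lemma nonassoc_algebra_quotient: "nonassoc_algebra K (quotient_algebra A I)"
  by (rule nonassoc_algebra_image[OF nonassoc_algebra_axioms quotient_proj_hom])
    (simp_all add: carrier_quotient_algebra coset_zero zero_quotient_algebra)

text \<open>\<open>g\<close> evaluates \<open>f\<close> at a chosen representative of the coset; two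
  representatives differ by an element of \<open>I\<close>, which \<open>f\<close> kills.\<close>

lemma quotient_hom_exists:
  assumes f: "f \<in> algebra_hom K A B" and B: "vectorspace K B" and ker: "\<And>x. x \<in> I \<Longrightarrow> f x = \<zero>\<^bsub>B\<^esub>"
  shows "\<exists>g\<in>algebra_hom K (quotient_algebra A I) B. \<forall>x\<in>carrier A. g (I +>\<^bsub>A\<^esub> x) = f x"
proof -
  interpret B: vectorspace K B by fact
  note fD = algebra_homD[OF f]
  define g where "g C = f (SOME x. x \<in> C)" for C
  have g: "g (I +>\<^bsub>A\<^esub> x) = f x" if x: "x \<in> carrier A" for x
  proof -
    define y where "y = (SOME y. y \<in> I +>\<^bsub>A\<^esub> x)"
    have y: "y \<in> I +>\<^bsub>A\<^esub> x" unfolding y_def using I.a_rcos_self[OF x] by (rule someI)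
    have yA: "y \<in> carrier A" using y x I.a_elemrcos_carrier by blast
    have "y \<ominus>\<^bsub>A\<^esub> x \<in> I" using y x by (simp add: a_minus_def I.a_rcos_module_imp)
    then have "f y \<ominus>\<^bsub>B\<^esub> f x = \<zero>\<^bsub>B\<^esub>"
      using algebra_hom_minus[OF f vectorspace_axioms B yA x] ker by simp
    then show ?thesis using x yA fD(1) by (simp add: g_def y_def[symmetric])
  qed
  note pD = algebra_homD[OF quotient_proj_hom]
  have "g \<in> algebra_hom K (quotient_algebra A I) B"
    by (rule algebra_homI)
      (auto simp: carrier_quotient_algebra pD(2-4)[symmetric] g fD prod_closed)
  then show ?thesis using g by blast
qed

end
lemma lie_algebra_subalgebra:
  assumes "lie_algebra K L" "subalgebra K H L"
  shows "lie_algebra K (L\<lparr>carrier := H\<rparr>)"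
proof -
  interpret lie_algebra K L by fact
  have "H \<subseteq> carrier L" using assms subspaceD(1) by (auto simp: subalgebra_def)
  then show ?thesis
    by (intro lie_algebra.intro nonassoc_algebra_subalgebra nonassoc_algebra_axioms assms
        lie_algebra_axioms.intro)
      (auto simp: bracket_self jacobi subset_iff)
qed

lemma lie_algebra_quotient:
  assumes "lie_algebra K L" "algebra_ideal K I L"
  shows "lie_algebra K (quotient_algebra L I)"
proof -
  interpret lie_algebra K L by fact
  interpret algebra_with_ideal K L I by unfold_locales fact
  show ?thesis
    by (rule lie_algebra_image[OF lie_algebra_axioms quotient_proj_hom])
      (simp_all add: carrier_quotient_algebra coset_zero zero_quotient_algebra)
qed

section \<open>Bracket identities in a Lie algebra\<close>

context lie_algebra
begin

text \<open>Polarisation: expand the vanishing square of the sum of \<open>x\<close> and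
  \<open>y\<close>.\<close>

lemma bracket_skew:
  assumes "x \<in> carrier L" "y \<in> carrier L"
  shows "x \<otimes>\<^bsub>L\<^esub> y = \<ominus>\<^bsub>L\<^esub> (y \<otimes>\<^bsub>L\<^esub> x)"
proof -
  have "(x \<oplus>\<^bsub>L\<^esub> y) \<otimes>\<^bsub>L\<^esub> (x \<oplus>\<^bsub>L\<^esub> y) = \<zero>\<^bsub>L\<^esub>" using assms by (intro bracket_self M.add.m_closed)
  then have "x \<otimes>\<^bsub>L\<^esub> y \<oplus>\<^bsub>L\<^esub> y \<otimes>\<^bsub>L\<^esub> x = \<zero>\<^bsub>L\<^esub>"
    using assms bracket_self[OF assms(1)] bracket_self[OF assms(2)]
    by (simp add: prod_add_left prod_add_right prod_closed M.a_comm)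
  then show ?thesis using assms prod_closed M.minus_equality by metis
qed

text \<open>The Jacobi identity with two of its terms reversed by skew symmetry: ad x is a
  derivation.\<close>

lemma bracket_leibniz:
  assumes "x \<in> carrier L" "y \<in> carrier L" "z \<in> carrier L"
  shows "x \<otimes>\<^bsub>L\<^esub> (y \<otimes>\<^bsub>L\<^esub> z) = (x \<otimes>\<^bsub>L\<^esub> y) \<otimes>\<^bsub>L\<^esub> z \<oplus>\<^bsub>L\<^esub> y \<otimes>\<^bsub>L\<^esub> (x \<otimes>\<^bsub>L\<^esub> z)"
proof -
  let ?a = "x \<otimes>\<^bsub>L\<^esub> (y \<otimes>\<^bsub>L\<^esub> z)" and ?b = "y \<otimes>\<^bsub>L\<^esub> (x \<otimes>\<^bsub>L\<^esub> z)" and ?c = "(x \<otimes>\<^bsub>L\<^esub> y) \<otimes>\<^bsub>L\<^esub> z"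
  have cl: "?a \<in> carrier L" "?b \<in> carrier L" "?c \<in> carrier L" using assms prod_closed by auto
  have "y \<otimes>\<^bsub>L\<^esub> (z \<otimes>\<^bsub>L\<^esub> x) = \<ominus>\<^bsub>L\<^esub> ?b" "z \<otimes>\<^bsub>L\<^esub> (x \<otimes>\<^bsub>L\<^esub> y) = \<ominus>\<^bsub>L\<^esub> ?c"
    using assms bracket_skew[of z x] bracket_skew[of z "x \<otimes>\<^bsub>L\<^esub> y"] prod_uminus(2)[of y "x \<otimes>\<^bsub>L\<^esub> z"]
      prod_closed by metis+
  with jacobi[OF assms] have "?a \<oplus>\<^bsub>L\<^esub> \<ominus>\<^bsub>L\<^esub> ?b \<oplus>\<^bsub>L\<^esub> \<ominus>\<^bsub>L\<^esub> ?c = \<zero>\<^bsub>L\<^esub>" by simp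
  then have "?a \<oplus>\<^bsub>L\<^esub> \<ominus>\<^bsub>L\<^esub> (?c \<oplus>\<^bsub>L\<^esub> ?b) = \<zero>\<^bsub>L\<^esub>" using cl by (simp add: M.minus_add M.a_ac M.add.inv_closed)
  then show ?thesis using cl M.r_neg M.minus_equality M.minus_minus M.add.m_closed
    by (metis M.add.inv_closed)
qed

lemma bracket_bracket:
  assumes "x \<in> carrier L" "y \<in> carrier L" "z \<in> carrier L"
  shows "(x \<otimes>\<^bsub>L\<^esub> y) \<otimes>\<^bsub>L\<^esub> z = x \<otimes>\<^bsub>L\<^esub> (y \<otimes>\<^bsub>L\<^esub> z) \<ominus>\<^bsub>L\<^esub> y \<otimes>\<^bsub>L\<^esub> (x \<otimes>\<^bsub>L\<^esub> z)"
  unfolding bracket_leibniz[OF assms] a_minus_def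
  using assms by (simp add: prod_closed M.a_assoc M.r_neg)

end

section \<open>Free nonassociative algebras\<close>

lemma lookup_scale: "Poly_Mapping.lookup (Poly_Mapping.map ((*) c) p) k = (c::'k::field) * Poly_Mapping.lookup p k"
  by (simp add: Poly_Mapping.map.rep_eq when_def)

lemma free_nonassoc_simps:
  "add (free_nonassoc X) = (+)" "zero (free_nonassoc X) = 0"
  "smult (free_nonassoc X) = (\<lambda>c. Poly_Mapping.map ((*) c))"
  by (simp_all add: free_nonassoc_def)

lemma carrier_free_nonassoc_iff:
  "p \<in> carrier (free_nonassoc X) \<longleftrightarrow> (\<forall>w. Poly_Mapping.lookup p w \<noteq> 0 \<longrightarrow> set_magma w \<subseteq> X)"
  by (auto simp: free_nonassoc_def in_keys_iff)

lemma free_nonassoc_add_closed: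
  assumes "p \<in> carrier (free_nonassoc X)" "q \<in> carrier (free_nonassoc X)"
  shows "p + q \<in> carrier (free_nonassoc X)"
  unfolding carrier_free_nonassoc_iff
proof (intro allI impI)
  fix w assume "Poly_Mapping.lookup (p + q) w \<noteq> 0"
  then have "Poly_Mapping.lookup p w \<noteq> 0 \<or> Poly_Mapping.lookup q w \<noteq> 0"
    by (auto simp: lookup_add)
  then show "set_magma w \<subseteq> X" using assms unfolding carrier_free_nonassoc_iff by blast
qed

lemma free_nonassoc_closed:
  "0 \<in> carrier (free_nonassoc X)"
  "set_magma w \<subseteq> X \<Longrightarrow> Poly_Mapping.single w c \<in> carrier (free_nonassoc X)"
  "p \<in> carrier (free_nonassoc X) \<Longrightarrow> - p \<in> carrier (free_nonassoc X)"
  "p \<in> carrier (free_nonassoc X) \<Longrightarrow> Poly_Mapping.map ((*) c) p \<in> carrier (free_nonassoc X)"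
  by (simp_all add: carrier_free_nonassoc_iff lookup_single when_def lookup_scale)

lemma free_nonassoc_sum_closed:
  assumes "\<And>i. i \<in> S \<Longrightarrow> f i \<in> carrier (free_nonassoc X)"
  shows "sum f S \<in> carrier (free_nonassoc X)"
  using assms by (induction S rule: infinite_finite_induct) (simp_all add: free_nonassoc_closed free_nonassoc_add_closed)

text \<open>The defining sum runs over the exact supports, and the support of p + q can shrink by
  cancellation. Distributivity needs one index set for several products, so the sums are extended by
  terms with coefficient zero.\<close>

lemma free_nonassoc_mult_eq_sum:
  assumes "finite S" "finite T" "Poly_Mapping.keys p \<subseteq> S" "Poly_Mapping.keys q \<subseteq> T"
  shows "p \<otimes>\<^bsub>free_nonassoc X\<^esub> q = (\<Sum>v\<in>S. \<Sum>w\<in>T.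
    Poly_Mapping.single (Prod v w) (Poly_Mapping.lookup p v * Poly_Mapping.lookup q w))"
proof -
  have "(\<Sum>w\<in>Poly_Mapping.keys q. Poly_Mapping.single (Prod v w)
      (Poly_Mapping.lookup p v * Poly_Mapping.lookup q w))
    = (\<Sum>w\<in>T. Poly_Mapping.single (Prod v w) (Poly_Mapping.lookup p v * Poly_Mapping.lookup q w))" for v
    using assms by (intro sum.mono_neutral_left) (auto simp: in_keys_iff)
  then show ?thesis
    unfolding free_nonassoc_def using assms
    by simp (intro sum.mono_neutral_left, auto simp: in_keys_iff)
qed

lemma free_nonassoc_mult_single:
  "Poly_Mapping.single v a \<otimes>\<^bsub>free_nonassoc X\<^esub> Poly_Mapping.single w b = Poly_Mapping.single (Prod v w) (a * b)"
  by (subst free_nonassoc_mult_eq_sum[where S = "{v}" and T = "{w}"]) (auto split: if_splits)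

lemma nonassoc_algebra_free_nonassoc:
  "nonassoc_algebra class_ring (free_nonassoc X :: ('k::field, 'x magma \<Rightarrow>\<^sub>0 'k) module)"
proof -
  let ?F = "free_nonassoc X :: ('k::field, 'x magma \<Rightarrow>\<^sub>0 'k) module"
  have vs: "vectorspace class_ring ?F"
  proof (rule vs_criteria)
    show "field (class_ring :: 'k ring)" by (rule class_field)
    show "\<forall>v\<in>carrier ?F. \<exists>w\<in>carrier ?F. v \<oplus>\<^bsub>?F\<^esub> w = \<zero>\<^bsub>?F\<^esub>"
      by (auto simp: free_nonassoc_simps intro!: bexI[of _ "- _"] free_nonassoc_closed)
  qed (auto simp: free_nonassoc_simps free_nonassoc_closed free_nonassoc_add_closed algebra_simps lookup_scale lookup_add
      intro!: poly_mapping_eqI)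
  have keys: "finite (Poly_Mapping.keys p \<union> Poly_Mapping.keys q)"
    "Poly_Mapping.keys p \<subseteq> Poly_Mapping.keys p \<union> Poly_Mapping.keys q"
    "Poly_Mapping.keys q \<subseteq> Poly_Mapping.keys p \<union> Poly_Mapping.keys q"
    "Poly_Mapping.keys (p + q) \<subseteq> Poly_Mapping.keys p \<union> Poly_Mapping.keys q"
    for p q :: "'x magma \<Rightarrow>\<^sub>0 'k"
    by (auto simp: keys_add)
  have keys_scale: "Poly_Mapping.keys (Poly_Mapping.map ((*) c) p) \<subseteq> Poly_Mapping.keys p"
    for c :: 'k and p :: "'x magma \<Rightarrow>\<^sub>0 'k"
    by (auto simp: in_keys_iff lookup_scale)
  note mult = free_nonassoc_mult_eq_sum[where X = X]
  show ?thesis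
  proof (intro nonassoc_algebra.intro vs nonassoc_algebra_axioms.intro)
    fix x y z :: "'x magma \<Rightarrow>\<^sub>0 'k"
    assume "x \<in> carrier ?F" "y \<in> carrier ?F"
    then show "x \<otimes>\<^bsub>?F\<^esub> y \<in> carrier ?F"
      unfolding mult[OF finite_keys finite_keys subset_refl subset_refl]
      by (intro free_nonassoc_sum_closed free_nonassoc_closed) (auto simp: free_nonassoc_def)
    show "(x \<oplus>\<^bsub>?F\<^esub> y) \<otimes>\<^bsub>?F\<^esub> z = x \<otimes>\<^bsub>?F\<^esub> z \<oplus>\<^bsub>?F\<^esub> y \<otimes>\<^bsub>?F\<^esub> z"
      unfolding free_nonassoc_simps
        mult[OF keys(1)[of x y] finite_keys keys(4) subset_refl]
        mult[OF keys(1)[of x y] finite_keys keys(2) subset_refl]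
        mult[OF keys(1)[of x y] finite_keys keys(3) subset_refl]
      by (simp add: lookup_add algebra_simps single_add sum.distrib)
    show "z \<otimes>\<^bsub>?F\<^esub> (x \<oplus>\<^bsub>?F\<^esub> y) = z \<otimes>\<^bsub>?F\<^esub> x \<oplus>\<^bsub>?F\<^esub> z \<otimes>\<^bsub>?F\<^esub> y"
      unfolding free_nonassoc_simps
        mult[OF finite_keys keys(1)[of x y] subset_refl keys(4)]
        mult[OF finite_keys keys(1)[of x y] subset_refl keys(2)]
        mult[OF finite_keys keys(1)[of x y] subset_refl keys(3)]
      by (simp add: lookup_add algebra_simps single_add sum.distrib)
    fix c :: 'k
    show "(c \<odot>\<^bsub>?F\<^esub> x) \<otimes>\<^bsub>?F\<^esub> y = c \<odot>\<^bsub>?F\<^esub> (x \<otimes>\<^bsub>?F\<^esub> y)"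
      unfolding free_nonassoc_simps
        mult[OF finite_keys[of x] finite_keys[of y] keys_scale subset_refl]
        mult[of "Poly_Mapping.keys x" "Poly_Mapping.keys y" x y, OF finite_keys finite_keys subset_refl subset_refl]
      by (rule poly_mapping_eqI)
        (simp add: lookup_scale lookup_sum lookup_single sum_distrib_left algebra_simps mult_when)
    show "x \<otimes>\<^bsub>?F\<^esub> (c \<odot>\<^bsub>?F\<^esub> y) = c \<odot>\<^bsub>?F\<^esub> (x \<otimes>\<^bsub>?F\<^esub> y)"
      unfolding free_nonassoc_simps
        mult[OF finite_keys[of x] finite_keys[of y] subset_refl keys_scale]
        mult[of "Poly_Mapping.keys x" "Poly_Mapping.keys y" x y, OF finite_keys finite_keys subset_refl subset_refl]
      by (rule poly_mapping_eqI)
        (simp add: lookup_scale lookup_sum lookup_single sum_distrib_left algebra_simps mult_when)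
  qed
qed

text \<open>Every element is the sum of its monomials. The induction over the support carries
  membership in the carrier along, since the \<open>add\<close> case offers it to the user of the
  rule.\<close>

lemma free_nonassoc_induct [consumes 1, case_names zero single add]:
  assumes p: "p \<in> carrier (free_nonassoc X)"
    and zero: "P 0"
    and single: "\<And>w c. set_magma w \<subseteq> X \<Longrightarrow> P (Poly_Mapping.single w c)"
    and add: "\<And>p q. \<lbrakk>p \<in> carrier (free_nonassoc X); q \<in> carrier (free_nonassoc X); P p; P q\<rbrakk> \<Longrightarrow> P (p + q)"
  shows "P p"
proof -
  have "(\<Sum>w\<in>S. Poly_Mapping.single w (Poly_Mapping.lookup p w)) \<in> carrier (free_nonassoc X) \<and>
      P (\<Sum>w\<in>S. Poly_Mapping.single w (Poly_Mapping.lookup p w))"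
    if "finite S" "S \<subseteq> Poly_Mapping.keys p" for S
    using that
  proof (induction S rule: finite_induct)
    case empty
    then show ?case by (simp add: zero free_nonassoc_closed)
  next
    case (insert w S)
    then have "set_magma w \<subseteq> X" using p by (auto simp: free_nonassoc_def)
    then show ?case using insert by (auto intro!: add single free_nonassoc_closed free_nonassoc_add_closed)
  qed
  from this[of "Poly_Mapping.keys p"]
  have "P (\<Sum>w\<in>Poly_Mapping.keys p. Poly_Mapping.single w (Poly_Mapping.lookup p w))" by simp
  also have "(\<Sum>w\<in>Poly_Mapping.keys p. Poly_Mapping.single w (Poly_Mapping.lookup p w)) = p"
    by (rule poly_mapping_eqI) (simp add: lookup_sum lookup_single when_def in_keys_iff)
  finally show ?thesis .
qed

primrec magma_eval :: "('k, 'a) module \<Rightarrow> ('x \<Rightarrow> 'a) \<Rightarrow> 'x magma \<Rightarrow> 'a" where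
  "magma_eval A u (Gen x) = u x"
| "magma_eval A u (Prod v w) = magma_eval A u v \<otimes>\<^bsub>A\<^esub> magma_eval A u w"

text \<open>The map is the linear extension of word evaluation. Multiplicativity is reduced by
  linearity in both arguments to single words, where it is the recursion equation of
  \<open>magma_eval\<close>.\<close>

lemma free_nonassoc_universal:
  fixes A :: "('k::field, 'a) module" and u :: "'x \<Rightarrow> 'a"
  assumes "nonassoc_algebra class_ring A" and u: "u \<in> X \<rightarrow> carrier A"
  shows "\<exists>f\<in>algebra_hom class_ring (free_nonassoc X) A. \<forall>x\<in>X. f (Poly_Mapping.single (Gen x) 1) = u x"
proof -
  interpret A: nonassoc_algebra class_ring A by fact
  interpret F: nonassoc_algebra class_ring "free_nonassoc X :: ('k, 'x magma \<Rightarrow>\<^sub>0 'k) module"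
    by (rule nonassoc_algebra_free_nonassoc)
  let ?F = "free_nonassoc X :: ('k, 'x magma \<Rightarrow>\<^sub>0 'k) module"
  let ?ev = "magma_eval A u"
  have ev: "?ev w \<in> carrier A" if "set_magma w \<subseteq> X" for w
    using that u by (induction w) (auto intro: A.prod_closed)
  have scale: "a \<odot>\<^bsub>A\<^esub> x \<in> carrier A" if "x \<in> carrier A" for a x
    using that by (intro A.smult_closed) simp_all
  define f where "f p = (\<Oplus>\<^bsub>A\<^esub>w\<in>Poly_Mapping.keys p. Poly_Mapping.lookup p w \<odot>\<^bsub>A\<^esub> ?ev w)" for p
  \<comment> \<open>As for products, additivity needs a common index set for \<open>p\<close>,
    \<open>q\<close> and \<open>p + q\<close>. The words must use letters from \<open>X\<close> so
    that their values lie in \<open>A\<close>.\<close>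
  have f_eq: "f p = (\<Oplus>\<^bsub>A\<^esub>w\<in>S. Poly_Mapping.lookup p w \<odot>\<^bsub>A\<^esub> ?ev w)"
    if "finite S" "Poly_Mapping.keys p \<subseteq> S" "\<And>w. w \<in> S \<Longrightarrow> set_magma w \<subseteq> X" for p S
    unfolding f_def using that ev A.smult_l_null
    by (intro A.M.add.finprod_mono_neutral_cong_left) (auto simp: in_keys_iff scale)
  have keys: "set_magma w \<subseteq> X" if "p \<in> carrier ?F" "w \<in> Poly_Mapping.keys p" for p w
    using that by (auto simp: free_nonassoc_def)
  have closed: "f p \<in> carrier A" if "p \<in> carrier ?F" for p
    unfolding f_def using keys[OF that] by (intro A.M.finsum_closed) (auto intro: scale ev)
  have f_zero: "f 0 = \<zero>\<^bsub>A\<^esub>" by (simp add: f_def)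
  have f_add: "f (p + q) = f p \<oplus>\<^bsub>A\<^esub> f q" if pq: "p \<in> carrier ?F" "q \<in> carrier ?F" for p q
  proof -
    let ?S = "Poly_Mapping.keys p \<union> Poly_Mapping.keys q"
    have S: "set_magma w \<subseteq> X" if "w \<in> ?S" for w using that keys pq by blast
    have "f (p + q) = (\<Oplus>\<^bsub>A\<^esub>w\<in>?S. Poly_Mapping.lookup p w \<odot>\<^bsub>A\<^esub> ?ev w \<oplus>\<^bsub>A\<^esub> Poly_Mapping.lookup q w \<odot>\<^bsub>A\<^esub> ?ev w)"
      using S ev A.smult_l_distr
      by (subst f_eq[of ?S]) (auto simp: keys_add lookup_add scale simp del: A.M.finsum_addf intro!: A.M.finsum_cong')
    also have "\<dots> = f p \<oplus>\<^bsub>A\<^esub> f q"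
      using S ev f_eq[of ?S p] f_eq[of ?S q] by (subst A.M.finsum_addf) (auto simp: scale)
    finally show ?thesis .
  qed
  have f_single: "f (Poly_Mapping.single w c) = c \<odot>\<^bsub>A\<^esub> ?ev w" if "set_magma w \<subseteq> X" for w c
    using that ev by (subst f_eq[of "{w}"]) (auto simp: scale)
  have smult: "f (Poly_Mapping.map ((*) c) p) = c \<odot>\<^bsub>A\<^esub> f p" if "p \<in> carrier ?F" for c p
    using that
  proof (induction rule: free_nonassoc_induct)
    case zero
    have "Poly_Mapping.map ((*) c) (0 :: 'x magma \<Rightarrow>\<^sub>0 'k) = 0"
      by (rule poly_mapping_eqI) (simp add: lookup_scale)
    then show ?case using A.smult_r_null by (simp add: f_zero)
  next
    case (single w d)
    then show ?case using A.smult_assoc1 ev by (simp add: f_single)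
  next
    case (add p q)
    have "Poly_Mapping.map ((*) c) (p + q) = Poly_Mapping.map ((*) c) p + Poly_Mapping.map ((*) c) q"
      by (rule poly_mapping_eqI) (simp add: lookup_scale lookup_add algebra_simps)
    then show ?case using add closed A.smult_r_distr
      by (simp add: f_add free_nonassoc_closed)
  qed
  have mult: "f (p \<otimes>\<^bsub>?F\<^esub> q) = f p \<otimes>\<^bsub>A\<^esub> f q" if p: "p \<in> carrier ?F" and q: "q \<in> carrier ?F" for p q
    using p
  proof (induction rule: free_nonassoc_induct)
    case zero
    then show ?case using F.prod_zero(1)[OF q] A.prod_zero(1)[OF closed[OF q]]
      by (simp add: f_zero free_nonassoc_simps)
  next
    case (add p p')
    then show ?case
      using F.prod_add_left[of p p' q] A.prod_add_left closed F.prod_closed q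
      by (simp add: f_add free_nonassoc_simps)
  next
    case (single v a)
    then have va: "Poly_Mapping.single v a \<in> carrier ?F" by (rule free_nonassoc_closed(2))
    show ?case using q
    proof (induction rule: free_nonassoc_induct)
      case zero
      show ?case
        using F.prod_zero(2) A.prod_zero(2) closed va
        by (simp add: f_zero free_nonassoc_simps)
    next
      case (add q q')
      then show ?case
        using F.prod_add_right[of q q' "Poly_Mapping.single v a"] A.prod_add_right closed F.prod_closed
          va
        by (simp add: f_add free_nonassoc_simps)
    next
      case (single w b)
      \<comment> \<open>Bilinearity may extract the two coefficients in either order; commutativity
        of the field identifies the results.\<close>
      have "b \<odot>\<^bsub>A\<^esub> (a \<odot>\<^bsub>A\<^esub> z) = a \<odot>\<^bsub>A\<^esub> (b \<odot>\<^bsub>A\<^esub> z)" if "z \<in> carrier A" for z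
        using A.smult_assoc1[of a b z] A.smult_assoc1[of b a z] that by (simp add: mult.commute)
      with single show ?case
        using \<open>set_magma v \<subseteq> X\<close> ev A.prod_smult_left A.prod_smult_right A.smult_assoc1 A.prod_closed
        by (simp add: free_nonassoc_mult_single f_single scale)
    qed
  qed
  have "f \<in> algebra_hom class_ring ?F A"
    by (rule algebra_homI) (simp_all add: closed f_add smult mult free_nonassoc_simps)
  moreover have "f (Poly_Mapping.single (Gen x) 1) = u x" if "x \<in> X" for x
    using f_single[of "Gen x" 1] that u A.smult_one by auto
  ultimately show ?thesis by blast
qed

section \<open>Presentations\<close>

lemma lie_axiom_relators_closed:
  assumes "nonassoc_algebra K A"
  shows "lie_axiom_relators A \<subseteq> carrier A"
proof -
  interpret nonassoc_algebra K A by fact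
  show ?thesis unfolding lie_axiom_relators_def by (auto intro!: prod_closed M.a_comm)
qed

context
  fixes X :: "'x set"
begin

lemma free_nonassoc_ideal:
  "algebra_with_ideal class_ring (free_nonassoc X :: ('k::field, 'x magma \<Rightarrow>\<^sub>0 'k) module) (lie_axiom_ideal X)"
  unfolding lie_axiom_ideal_def
  by (intro algebra_with_ideal.intro algebra_with_ideal_axioms.intro algebra_ideal_generated_ideal(1)
      nonassoc_algebra_free_nonassoc algebra_ideal_carrier
      lie_axiom_relators_closed[OF nonassoc_algebra_free_nonassoc])

interpretation N: algebra_with_ideal class_ring
    "free_nonassoc X :: ('k::field, 'x magma \<Rightarrow>\<^sub>0 'k) module" "lie_axiom_ideal X"
  by (rule free_nonassoc_ideal)

lemma lie_axiom_ideal_relators: "lie_axiom_relators (free_nonassoc X) \<subseteq> lie_axiom_ideal X"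
  unfolding lie_axiom_ideal_def
  by (intro algebra_ideal_generated_ideal(2) nonassoc_algebra_free_nonassoc algebra_ideal_carrier
      lie_axiom_relators_closed[OF nonassoc_algebra_free_nonassoc])

text \<open>On representatives the left-hand side of each axiom is an element of
  \<open>lie_axiom_relators\<close>, so its coset is the ideal itself, the zero of the
  quotient.\<close>

lemma lie_algebra_free_lie: "lie_algebra class_ring (free_lie X :: ('k::field, ('x magma \<Rightarrow>\<^sub>0 'k) set) module)"
proof -
  let ?F = "free_nonassoc X :: ('k::field, 'x magma \<Rightarrow>\<^sub>0 'k) module"
  let ?I = "lie_axiom_ideal X :: ('x magma \<Rightarrow>\<^sub>0 'k) set"
  note p = algebra_homD(2-4)[OF N.quotient_proj_hom, symmetric]
  have coset: "?I +>\<^bsub>?F\<^esub> r = ?I" if "r \<in> lie_axiom_relators ?F" for r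
    using that lie_axiom_ideal_relators N.I.a_rcos_const by blast
  show ?thesis
    unfolding free_lie_def
  proof (intro lie_algebra.intro lie_algebra_axioms.intro N.nonassoc_algebra_quotient)
    fix x y z
    assume "x \<in> carrier (quotient_algebra ?F ?I)"
    then obtain x' where x': "x = ?I +>\<^bsub>?F\<^esub> x'" "x' \<in> carrier ?F"
      unfolding N.carrier_quotient_algebra by auto
    have "x' \<otimes>\<^bsub>?F\<^esub> x' \<in> lie_axiom_relators ?F" using x' unfolding lie_axiom_relators_def by blast
    then show "x \<otimes>\<^bsub>quotient_algebra ?F ?I\<^esub> x = \<zero>\<^bsub>quotient_algebra ?F ?I\<^esub>"
      using x'(2) unfolding x'(1) N.zero_quotient_algebra by (simp add: p coset)
    assume "y \<in> carrier (quotient_algebra ?F ?I)" "z \<in> carrier (quotient_algebra ?F ?I)"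
    then obtain y' z' where yz: "y = ?I +>\<^bsub>?F\<^esub> y'" "y' \<in> carrier ?F" "z = ?I +>\<^bsub>?F\<^esub> z'" "z' \<in> carrier ?F"
      unfolding N.carrier_quotient_algebra by auto
    have "x' \<otimes>\<^bsub>?F\<^esub> (y' \<otimes>\<^bsub>?F\<^esub> z') \<oplus>\<^bsub>?F\<^esub> y' \<otimes>\<^bsub>?F\<^esub> (z' \<otimes>\<^bsub>?F\<^esub> x') \<oplus>\<^bsub>?F\<^esub> z' \<otimes>\<^bsub>?F\<^esub> (x' \<otimes>\<^bsub>?F\<^esub> y')
        \<in> lie_axiom_relators ?F"
      using x' yz unfolding lie_axiom_relators_def by blast
    from coset[OF this] show "x \<otimes>\<^bsub>quotient_algebra ?F ?I\<^esub> (y \<otimes>\<^bsub>quotient_algebra ?F ?I\<^esub> z)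
        \<oplus>\<^bsub>quotient_algebra ?F ?I\<^esub> y \<otimes>\<^bsub>quotient_algebra ?F ?I\<^esub> (z \<otimes>\<^bsub>quotient_algebra ?F ?I\<^esub> x)
        \<oplus>\<^bsub>quotient_algebra ?F ?I\<^esub> z \<otimes>\<^bsub>quotient_algebra ?F ?I\<^esub> (x \<otimes>\<^bsub>quotient_algebra ?F ?I\<^esub> y)
        = \<zero>\<^bsub>quotient_algebra ?F ?I\<^esub>"
      using x' yz by (simp add: p N.zero_quotient_algebra N.prod_closed)
  qed
qed

lemma free_lie_gen_closed:
  "x \<in> X \<Longrightarrow> (free_lie_gen X x :: ('x magma \<Rightarrow>\<^sub>0 'k::field) set) \<in> carrier (free_lie X)"
  unfolding free_lie_def free_lie_gen_def N.carrier_quotient_algebra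
  by (intro imageI free_nonassoc_closed) simp

text \<open>The extension \<open>f\<close> to the free nonassociative algebra has as kernel
  \<open>J\<close> an ideal. It contains the Lie axiom relators because \<open>L\<close> satisfies
  the axioms, so \<open>f\<close> factors through the quotient.\<close>

lemma free_lie_universal:
  fixes L :: "('k::field, 'a) module"
  assumes "lie_algebra class_ring L" and u: "u \<in> X \<rightarrow> carrier L"
  shows "\<exists>f\<in>algebra_hom class_ring (free_lie X) L. \<forall>x\<in>X. f (free_lie_gen X x) = u x"
proof -
  interpret L: lie_algebra class_ring L by fact
  let ?F = "free_nonassoc X :: ('k, 'x magma \<Rightarrow>\<^sub>0 'k) module"
  obtain f where f: "f \<in> algebra_hom class_ring ?F L"
    and fu: "\<And>x. x \<in> X \<Longrightarrow> f (Poly_Mapping.single (Gen x) 1) = u x"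
    using free_nonassoc_universal[OF L.nonassoc_algebra_axioms u] by auto
  note fD = algebra_homD[OF f]
  note f0 = algebra_hom_zero[OF f N.vectorspace_axioms L.vectorspace_axioms]
  define J where "J = {p \<in> carrier ?F. f p = \<zero>\<^bsub>L\<^esub>}"
  have "algebra_ideal class_ring J ?F"
    unfolding algebra_ideal_def
  proof (intro conjI ballI subspaceI N.vectorspace_axioms)
    show "\<zero>\<^bsub>?F\<^esub> \<in> J" using f0 by (simp add: J_def)
    fix c x assume "c \<in> carrier (class_ring :: 'k ring)" "x \<in> J"
    then show "c \<odot>\<^bsub>?F\<^esub> x \<in> J"
      using fD(3)[of c x] N.smult_closed[of c x] L.smult_r_null[of c] by (simp add: J_def)
  qed (auto simp: J_def fD N.prod_closed L.prod_zero)
  moreover have "lie_axiom_relators ?F \<subseteq> J"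
    by (auto simp: lie_axiom_relators_def J_def fD N.prod_closed L.bracket_self L.jacobi)
  ultimately have "lie_axiom_ideal X \<subseteq> J"
    unfolding lie_axiom_ideal_def
    by (intro algebra_ideal_generated_ideal(3) nonassoc_algebra_free_nonassoc algebra_ideal_carrier
        lie_axiom_relators_closed[OF nonassoc_algebra_free_nonassoc])
  then have "f x = \<zero>\<^bsub>L\<^esub>" if "x \<in> lie_axiom_ideal X" for x
    using that by (auto simp: J_def)
  from N.quotient_hom_exists[OF f L.vectorspace_axioms this]
  obtain g where "g \<in> algebra_hom class_ring (free_lie X) L"
    "\<And>p. p \<in> carrier ?F \<Longrightarrow> g (lie_axiom_ideal X +>\<^bsub>?F\<^esub> p) = f p"
    by (auto simp: free_lie_def)
  then show ?thesis
    using fu by (intro bexI[of _ g]) (auto simp: free_lie_gen_def free_nonassoc_closed)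
qed

end

section \<open>Presented Lie algebras: universal property, spanning criterion, recognition
  criterion\<close>

locale lie_presentation =
  fixes X :: "'x set" and Rel :: "('x, 'k::field) lie_relation set"
  assumes Rel_closed: "Rel \<subseteq> carrier (free_lie X) \<times> carrier (free_lie X)"
begin

abbreviation F :: "('k, ('x magma \<Rightarrow>\<^sub>0 'k) set) module" where "F \<equiv> free_lie X"
abbreviation P :: "('k, ('x magma \<Rightarrow>\<^sub>0 'k) set set) module" where "P \<equiv> presented_lie X Rel"
abbreviation gen :: "'x \<Rightarrow> ('x magma \<Rightarrow>\<^sub>0 'k) set set" where "gen \<equiv> presented_gen X Rel"

sublocale F: lie_algebra class_ring F
  by (rule lie_algebra_free_lie)

text \<open>Needed for \<open>relation_ideal\<close> to be an ideal: only then is the whole free Lie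
  algebra among the ideals that contain the relators.\<close>

lemma relators_closed: "{p \<ominus>\<^bsub>F\<^esub> q | p q. (p, q) \<in> Rel} \<subseteq> carrier F"
  using Rel_closed by auto

sublocale F: algebra_with_ideal class_ring F "relation_ideal X Rel"
  unfolding relation_ideal_def
  by (intro algebra_with_ideal.intro algebra_with_ideal_axioms.intro algebra_ideal_generated_ideal(1)
      F.nonassoc_algebra_axioms algebra_ideal_carrier relators_closed)

sublocale P: lie_algebra class_ring P
  unfolding presented_lie_def by (rule lie_algebra_quotient[OF F.lie_algebra_axioms F.ideal])

definition proj :: "('x magma \<Rightarrow>\<^sub>0 'k) set \<Rightarrow> ('x magma \<Rightarrow>\<^sub>0 'k) set set" where
  "proj p = relation_ideal X Rel +>\<^bsub>F\<^esub> p"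

lemma proj_hom: "proj \<in> algebra_hom class_ring F P"
  using F.quotient_proj_hom unfolding proj_def[abs_def] presented_lie_def .

lemma proj_surj: "proj ` carrier F = carrier P"
  unfolding proj_def[abs_def] presented_lie_def F.carrier_quotient_algebra ..

lemma proj_gen: "proj (free_lie_gen X x) = gen x"
  by (simp add: proj_def presented_gen_def)

lemma gen_closed: "x \<in> X \<Longrightarrow> gen x \<in> carrier P"
  unfolding proj_gen[symmetric] by (intro algebra_homD(1)[OF proj_hom] free_lie_gen_closed)

lemma proj_eq:
  assumes "(p, q) \<in> Rel"
  shows "proj p = proj q"
proof -
  have "p \<ominus>\<^bsub>F\<^esub> q \<in> relation_ideal X Rel"
    using algebra_ideal_generated_ideal(2)[OF algebra_ideal_carrier[OF F.nonassoc_algebra_axioms] relators_closed]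
      assms unfolding relation_ideal_def by blast
  then show ?thesis
    using assms Rel_closed F.ideal_coset_eq_iff unfolding proj_def by blast
qed

text \<open>The homomorphism from the free Lie algebra is available only through an existence
  statement, so \<open>rel\<close> speaks of every \<open>f\<close> that extends \<open>u\<close>.
  The relations hold in \<open>L\<close> exactly when the relators lie in the kernel
  \<open>J\<close>.\<close>

lemma hom_exists:
  fixes L :: "('k, 'a) module"
  assumes "lie_algebra class_ring L" and u: "u \<in> X \<rightarrow> carrier L"
    and rel: "\<And>f p q. \<lbrakk>f \<in> algebra_hom class_ring F L; \<And>x. x \<in> X \<Longrightarrow> f (free_lie_gen X x) = u x;
      (p, q) \<in> Rel\<rbrakk> \<Longrightarrow> f p = f q"
  shows "\<exists>g\<in>algebra_hom class_ring P L. \<forall>x\<in>X. g (gen x) = u x"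
proof -
  interpret L: lie_algebra class_ring L by fact
  obtain f where f: "f \<in> algebra_hom class_ring F L"
    and fu: "\<And>x. x \<in> X \<Longrightarrow> f (free_lie_gen X x) = u x"
    using free_lie_universal[OF L.lie_algebra_axioms u] by auto
  note fD = algebra_homD[OF f]
  note f0 = algebra_hom_zero[OF f F.vectorspace_axioms L.vectorspace_axioms]
  note fm = algebra_hom_minus[OF f F.vectorspace_axioms L.vectorspace_axioms]
  define J where "J = {p \<in> carrier F. f p = \<zero>\<^bsub>L\<^esub>}"
  have "algebra_ideal class_ring J F"
    unfolding algebra_ideal_def
  proof (intro conjI ballI subspaceI F.vectorspace_axioms)
    show "\<zero>\<^bsub>F\<^esub> \<in> J" using f0 by (simp add: J_def)
    fix c x assume "c \<in> carrier (class_ring :: 'k ring)" "x \<in> J"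
    then show "c \<odot>\<^bsub>F\<^esub> x \<in> J"
      using fD(3)[of c x] F.smult_closed[of c x] L.smult_r_null[of c] by (simp add: J_def)
  qed (auto simp: J_def fD F.prod_closed L.prod_zero)
  moreover have "{p \<ominus>\<^bsub>F\<^esub> q | p q. (p, q) \<in> Rel} \<subseteq> J"
  proof safe
    fix p q assume pq: "(p, q) \<in> Rel"
    then have "p \<in> carrier F" "q \<in> carrier F" using Rel_closed by auto
    moreover have "f p = f q" using rel[OF f fu pq] .
    ultimately show "p \<ominus>\<^bsub>F\<^esub> q \<in> J"
      using fD(1)[of q] fm[of p q] by (simp add: J_def L.M.r_neg)
  qed
  ultimately have "relation_ideal X Rel \<subseteq> J"
    unfolding relation_ideal_def
    by (intro algebra_ideal_generated_ideal(3) F.nonassoc_algebra_axioms algebra_ideal_carrier relators_closed)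
  then have "f x = \<zero>\<^bsub>L\<^esub>" if "x \<in> relation_ideal X Rel" for x
    using that by (auto simp: J_def)
  from F.quotient_hom_exists[OF f L.vectorspace_axioms this]
  obtain g where g: "g \<in> algebra_hom class_ring P L" and gf: "\<And>p. p \<in> carrier F \<Longrightarrow> g (proj p) = f p"
    by (auto simp: presented_lie_def proj_def)
  have "g (gen x) = u x" if "x \<in> X" for x
    using gf[OF free_lie_gen_closed[OF that]] fu[OF that] by (simp add: proj_gen)
  with g show ?thesis by blast
qed

text \<open>
  The elements \<open>a\<close> with \<open>[a, H] \<subseteq> H\<close> form a subalgebra; it contains the generators, so \<open>H\<close> absorbs
  brackets with arbitrary elements.
\<close>

lemma subspace_ad_stable_eq_carrier:
  assumes H: "VectorSpace.subspace class_ring H P"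
    and gen: "\<And>x. x \<in> X \<Longrightarrow> gen x \<in> H"
    and ad: "\<And>x h. x \<in> X \<Longrightarrow> h \<in> H \<Longrightarrow> gen x \<otimes>\<^bsub>P\<^esub> h \<in> H"
  shows "H = carrier P"
proof
  note HD = subspaceD[OF H]
  show "H \<subseteq> carrier P" by (rule HD(1))
  note [simp] = subsetD[OF HD(1)]
  let ?N = "free_nonassoc X :: ('k, 'x magma \<Rightarrow>\<^sub>0 'k) module"
  interpret N: algebra_with_ideal class_ring ?N "lie_axiom_ideal X"
    by (rule free_nonassoc_ideal)
  \<comment> \<open>Both projections in one map: every element of \<open>P\<close> becomes the image
    of a linear combination of words, so induction on words is possible.\<close>
  define \<pi> where "\<pi> p = proj (lie_axiom_ideal X +>\<^bsub>?N\<^esub> p)" for p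
  have \<pi>: "\<pi> \<in> algebra_hom class_ring ?N P"
    unfolding \<pi>_def[abs_def]
    using algebra_hom_compose[OF N.quotient_proj_hom[folded free_lie_def] proj_hom] .
  have surj: "\<pi> ` carrier ?N = carrier P"
    unfolding \<pi>_def[abs_def] proj_surj[symmetric] free_lie_def N.carrier_quotient_algebra by auto
  have \<pi>_gen: "\<pi> (Poly_Mapping.single (Gen x) 1) = gen x" for x
    unfolding \<pi>_def proj_gen[symmetric] by (simp add: free_lie_gen_def)
  note \<pi>D = algebra_homD[OF \<pi>]
  let ?w = "\<lambda>w. Poly_Mapping.single w (1 :: 'k)"
  have w_closed: "\<pi> (?w w) \<in> carrier P" if "set_magma w \<subseteq> X" for w
    using that by (intro \<pi>D free_nonassoc_closed)
  have prod: "\<pi> (?w (Prod v w)) = \<pi> (?w v) \<otimes>\<^bsub>P\<^esub> \<pi> (?w w)" if "set_magma v \<subseteq> X" "set_magma w \<subseteq> X" for v w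
    using \<pi>D(4)[of "?w v" "?w w"] that by (simp add: free_nonassoc_closed free_nonassoc_mult_single)
  \<comment> \<open>Induction on the word acting on \<open>H\<close>. The element \<open>h\<close>
    stays arbitrary because the commutator formula applies each factor to the result of the
    other.\<close>
  have ad_w: "\<pi> (?w w) \<otimes>\<^bsub>P\<^esub> h \<in> H" if "set_magma w \<subseteq> X" "h \<in> H" for w h
    using that
  proof (induction w arbitrary: h)
    case (Gen x)
    then show ?case using ad by (simp add: \<pi>_gen)
  next
    case (Prod v w)
    then have vw: "\<pi> (?w v) \<in> carrier P" "\<pi> (?w w) \<in> carrier P" by (simp_all add: w_closed)
    have "\<pi> (?w (Prod v w)) \<otimes>\<^bsub>P\<^esub> h
        = \<pi> (?w v) \<otimes>\<^bsub>P\<^esub> (\<pi> (?w w) \<otimes>\<^bsub>P\<^esub> h) \<ominus>\<^bsub>P\<^esub> \<pi> (?w w) \<otimes>\<^bsub>P\<^esub> (\<pi> (?w v) \<otimes>\<^bsub>P\<^esub> h)"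
      using vw Prod.prems by (simp add: prod P.bracket_bracket)
    also have "\<dots> \<in> H" using Prod by (intro subspace_minus[OF H]) simp_all
    finally show ?case .
  qed
  \<comment> \<open>For a product of words, the second factor is in \<open>H\<close> by induction
    and the first maps it into \<open>H\<close> by \<open>ad_w\<close>.\<close>
  have w_H: "\<pi> (?w w) \<in> H" if "set_magma w \<subseteq> X" for w
    using that
  proof (induction w)
    case (Prod v w)
    then show ?case by (simp add: prod ad_w)
  qed (simp add: \<pi>_gen gen)
  have "\<pi> p \<in> H" if "p \<in> carrier ?N" for p
    using that
  proof (induction rule: free_nonassoc_induct)
    case zero
    show ?case
      using algebra_hom_zero[OF \<pi> N.vectorspace_axioms P.vectorspace_axioms] HD(2)
      by (simp add: free_nonassoc_simps)
  next
    case (single w c)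
    have "\<pi> (Poly_Mapping.single w c) = c \<odot>\<^bsub>P\<^esub> \<pi> (?w w)"
      using \<pi>D(3)[of c "?w w"] single by (simp add: free_nonassoc_simps free_nonassoc_closed)
    then show ?case using HD(4)[of c] w_H[OF single] by simp
  next
    case (add p q)
    then show ?case using \<pi>D(2)[of p q] HD(3) by (simp add: free_nonassoc_simps)
  qed
  then show "carrier P \<subseteq> H" unfolding surj[symmetric] by blast
qed

text \<open>The image of the homomorphism from \<open>P\<close> is a subalgebra containing the
  generators, which gives surjectivity by \<open>generated\<close>; by linearity a trivial kernel
  gives injectivity. As in \<open>hom_exists\<close>, \<open>rel\<close> and \<open>inj\<close>
  quantify over every homomorphism with the right values on generators.\<close>

lemma has_lie_presentationI:
  fixes L :: "('k, 'a) module"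
  assumes L: "lie_algebra class_ring L" and u: "u \<in> X \<rightarrow> carrier L"
    and rel: "\<And>f p q. \<lbrakk>f \<in> algebra_hom class_ring F L; \<And>x. x \<in> X \<Longrightarrow> f (free_lie_gen X x) = u x;
      (p, q) \<in> Rel\<rbrakk> \<Longrightarrow> f p = f q"
    and generated: "\<And>H. subalgebra class_ring H L \<Longrightarrow> u ` X \<subseteq> H \<Longrightarrow> carrier L \<subseteq> H"
    and inj: "\<And>g y. \<lbrakk>g \<in> algebra_hom class_ring P L; \<And>x. x \<in> X \<Longrightarrow> g (gen x) = u x;
      y \<in> carrier P; g y = \<zero>\<^bsub>L\<^esub>\<rbrakk> \<Longrightarrow> y = \<zero>\<^bsub>P\<^esub>"
  shows "has_lie_presentation L X u Rel"
proof -
  interpret L: lie_algebra class_ring L by (rule L)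
  obtain g where g: "g \<in> algebra_hom class_ring P L" and gu: "\<And>x. x \<in> X \<Longrightarrow> g (gen x) = u x"
    using hom_exists[OF L u rel] by blast
  note gD = algebra_homD[OF g]
  note gm = algebra_hom_minus[OF g P.vectorspace_axioms L.vectorspace_axioms]
  have "subalgebra class_ring (g ` carrier P) L"
    unfolding subalgebra_def
  proof (intro conjI ballI subspaceI L.vectorspace_axioms)
    show "\<zero>\<^bsub>L\<^esub> \<in> g ` carrier P"
      using algebra_hom_zero[OF g P.vectorspace_axioms L.vectorspace_axioms] by (metis P.M.zero_closed imageI)
    fix c x assume "c \<in> carrier (class_ring :: 'k ring)" "x \<in> g ` carrier P"
    then show "c \<odot>\<^bsub>L\<^esub> x \<in> g ` carrier P"
      using gD(3)[symmetric, of c] P.smult_closed[of c] by auto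
  qed (auto simp: gD P.prod_closed simp flip: gD(2,4))
  moreover have "u ` X \<subseteq> g ` carrier P"
    using gu gen_closed by force
  ultimately have "carrier L \<subseteq> g ` carrier P" by (rule generated)
  then have surj: "g ` carrier P = carrier L" using gD(1) by auto
  have "inj_on g (carrier P)"
  proof (rule inj_onI)
    fix x y assume xy: "x \<in> carrier P" "y \<in> carrier P" "g x = g y"
    then have "g (x \<ominus>\<^bsub>P\<^esub> y) = \<zero>\<^bsub>L\<^esub>" using gD(1)[of y] gm[of x y] by simp
    then have "x \<ominus>\<^bsub>P\<^esub> y = \<zero>\<^bsub>P\<^esub>" using inj[OF g gu] xy by simp
    then show "x = y" using xy by simp
  qed
  with surj have "g \<in> algebra_iso class_ring P L"
    using g by (simp add: algebra_iso_def algebra_hom_def bij_betw_def)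
  with gu show ?thesis
    using L u unfolding has_lie_presentation_def by blast
qed

end

section \<open>Lie algebras satisfying the relations\<close>

text \<open>Only the relations are assumed, so that the presented algebra itself is an instance. The
  coefficient field must allow the division by 2 in \<open>bracket_w_next\<close>.\<close>

locale sl_b_relators = lie_algebra class_ring L
  for L :: "('k::field_char_0, 'a) module" +
  fixes n :: nat and b :: "nat \<Rightarrow> 'k" and x :: "nat \<Rightarrow> 'a"
  assumes x_closed: "\<And>i. i \<in> {1..n-1} \<Longrightarrow> x i \<in> carrier L"
    and x_commute: "\<And>i j. \<lbrakk>i \<in> {1..n-1}; j \<in> {1..n-1}; \<bar>int i - int j\<bar> > 1\<rbrakk>
      \<Longrightarrow> x i \<otimes>\<^bsub>L\<^esub> x j = \<zero>\<^bsub>L\<^esub>"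
    and x_serre: "\<And>i j. \<lbrakk>i \<in> {1..n-1}; j \<in> {1..n-1}; \<bar>int i - int j\<bar> = 1\<rbrakk>
      \<Longrightarrow> x i \<otimes>\<^bsub>L\<^esub> (x i \<otimes>\<^bsub>L\<^esub> x j) = (- 2 * b (min i j)) \<odot>\<^bsub>L\<^esub> x i"

text \<open>For b = 0 and the generators e_i of sl_n this is E_(i,i+d+1), the root vector of alpha_i
  + ... + alpha_(i+d). Algebra and generators are parameters because the same bracket is compared in
  the presented algebra and in \<open>sl n\<close>.\<close>

primrec root_vector :: "('k, 'a) module \<Rightarrow> (nat \<Rightarrow> 'a) \<Rightarrow> nat \<Rightarrow> nat \<Rightarrow> 'a" where
  "root_vector L x 0 i = x i"
| "root_vector L x (Suc d) i = x i \<otimes>\<^bsub>L\<^esub> root_vector L x d (Suc i)"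

context sl_b_relators
begin

abbreviation w :: "nat \<Rightarrow> nat \<Rightarrow> 'a" where "w \<equiv> root_vector L x"

text \<open>The bound \<open>m\<close> on the left end is the invariant that carries the induction
  in \<open>bracket_w_right\<close>.\<close>

definition root_vectors :: "nat \<Rightarrow> 'a set" where
  "root_vectors m = {w d i | d i. m \<le> i \<and> i + d \<le> n - 1}"

lemma smult_in_carrier [simp]: "y \<in> carrier L \<Longrightarrow> c \<odot>\<^bsub>L\<^esub> y \<in> carrier L"
  using smult_closed[of c y] by simp

lemma w_closed:
  assumes "1 \<le> i" "i + d \<le> n - 1"
  shows "w d i \<in> carrier L"
  using assms
proof (induction d arbitrary: i)
  case (Suc d)
  then show ?case by (simp add: prod_closed x_closed)
qed (simp add: x_closed)

lemma root_vectors_closed: "1 \<le> m \<Longrightarrow> root_vectors m \<subseteq> carrier L"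
  by (auto simp: root_vectors_def w_closed)

lemma root_vectors_mono: "m \<le> m' \<Longrightarrow> root_vectors m' \<subseteq> root_vectors m"
  unfolding root_vectors_def using order_trans by blast

lemma finite_root_vectors: "finite (root_vectors m)"
proof -
  have "root_vectors m \<subseteq> (\<lambda>(d, i). w d i) ` ({..n} \<times> {..n})"
    by (force simp: root_vectors_def)
  then show ?thesis by (rule finite_subset) simp
qed

lemma span_root_vectors_subspace:
  "1 \<le> m \<Longrightarrow> VectorSpace.subspace class_ring (span (root_vectors m)) L"
  by (intro span_is_subspace root_vectors_closed)

lemma w_in_span:
  assumes "1 \<le> m" "m \<le> i" "i + d \<le> n - 1"
  shows "w d i \<in> span (root_vectors m)"
  using in_own_span[OF root_vectors_closed[OF assms(1)]] assms(2,3)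
  by (auto simp: root_vectors_def)

text \<open>The elements whose bracket with \<open>a\<close> falls into \<open>S\<close> form a
  subspace, so testing root vectors is enough.\<close>

lemma bracket_span:
  assumes m: "1 \<le> m" and S: "VectorSpace.subspace class_ring S L" and a: "a \<in> carrier L"
    and gen: "\<And>d i. m \<le> i \<Longrightarrow> i + d \<le> n - 1 \<Longrightarrow> a \<otimes>\<^bsub>L\<^esub> w d i \<in> S"
    and y: "y \<in> span (root_vectors m)"
  shows "a \<otimes>\<^bsub>L\<^esub> y \<in> S"
proof -
  note SD = subspaceD[OF S]
  let ?H = "{y \<in> carrier L. a \<otimes>\<^bsub>L\<^esub> y \<in> S}"
  have "VectorSpace.subspace class_ring ?H L"
  proof (rule subspaceI)
    show "vectorspace class_ring L" by (rule vectorspace_axioms)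
    show "\<zero>\<^bsub>L\<^esub> \<in> ?H" using prod_zero(2)[OF a] SD(2) by simp
    fix c y assume "y \<in> ?H"
    then show "c \<odot>\<^bsub>L\<^esub> y \<in> ?H" using prod_smult_right[of c a y] a SD(4)[of c] by simp
  qed (auto simp: prod_add_right a SD(3))
  then have sub: "LinearCombinations.submodule class_ring ?H L" by simp
  have "root_vectors m \<subseteq> ?H"
    using gen w_closed m by (force simp: root_vectors_def)
  from span_is_subset[OF this sub] y show ?thesis by blast
qed

section \<open>Brackets of a generator with a root vector\<close>

lemma bracket_commuting:
  assumes "y \<in> carrier L" "z \<in> carrier L" "v \<in> carrier L" "y \<otimes>\<^bsub>L\<^esub> z = \<zero>\<^bsub>L\<^esub>"
  shows "y \<otimes>\<^bsub>L\<^esub> (z \<otimes>\<^bsub>L\<^esub> v) = z \<otimes>\<^bsub>L\<^esub> (y \<otimes>\<^bsub>L\<^esub> v)"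
  using assms by (simp add: bracket_leibniz[of y z v] prod_zero prod_closed)

text \<open>Every letter of the root vector has index at least \<open>i\<close>, hence commutes with
  \<open>x k\<close>.\<close>

lemma bracket_w_far_left:
  assumes "1 \<le> k" "k + 1 < i" "i + d \<le> n - 1"
  shows "x k \<otimes>\<^bsub>L\<^esub> w d i = \<zero>\<^bsub>L\<^esub>"
  using assms
proof (induction d arbitrary: i)
  case 0
  then show ?case by (simp add: x_commute)
next
  case (Suc d)
  have "x k \<otimes>\<^bsub>L\<^esub> w (Suc d) i = x i \<otimes>\<^bsub>L\<^esub> (x k \<otimes>\<^bsub>L\<^esub> w d (Suc i))"
    using Suc.prems by (simp add: bracket_commuting x_closed x_commute w_closed)
  then show ?case using Suc.IH[of "Suc i"] Suc.prems by (simp add: prod_zero x_closed)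
qed

text \<open>For d >= 2 write the root vector as [a, [y, v]] with [a, v] = 0. The derivation ad a
  then acts on y alone, and the relation turns [[a, [a, y]], v] into a multiple of [a, v] =
  0.\<close>

lemma bracket_w_same:
  assumes "1 \<le> i" "i + d \<le> n - 1"
  shows "x i \<otimes>\<^bsub>L\<^esub> w d i = (if d = 1 then (- 2 * b i) \<odot>\<^bsub>L\<^esub> x i else \<zero>\<^bsub>L\<^esub>)"
proof -
  consider "d = 0" | "d = 1" | d' where "d = Suc (Suc d')"
    by (metis One_nat_def old.nat.exhaust)
  then show ?thesis
  proof cases
    case 1
    then show ?thesis using assms by (simp add: bracket_self x_closed)
  next
    case 2
    then show ?thesis using assms x_serre[of i "Suc i"] by simp
  next
    case 3
    let ?v = "w d' (Suc (Suc i))" and ?a = "x i" and ?y = "x (Suc i)"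
    have cl: "?a \<in> carrier L" "?y \<in> carrier L" "?v \<in> carrier L"
      using assms 3 by (simp_all add: x_closed w_closed)
    have av: "?a \<otimes>\<^bsub>L\<^esub> ?v = \<zero>\<^bsub>L\<^esub>" using assms 3 by (intro bracket_w_far_left) simp_all
    have "?a \<otimes>\<^bsub>L\<^esub> (?a \<otimes>\<^bsub>L\<^esub> (?y \<otimes>\<^bsub>L\<^esub> ?v)) = (?a \<otimes>\<^bsub>L\<^esub> (?a \<otimes>\<^bsub>L\<^esub> ?y)) \<otimes>\<^bsub>L\<^esub> ?v"
      using cl av by (simp add: bracket_leibniz[of ?a ?y ?v] bracket_leibniz[of ?a "?a \<otimes>\<^bsub>L\<^esub> ?y" ?v] prod_zero prod_closed)
    also have "\<dots> = \<zero>\<^bsub>L\<^esub>"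
      using x_serre[of i "Suc i"] assms 3 prod_smult_left[of "- 2 * b i" ?a ?v] cl av
        smult_r_null[of "- 2 * b i"] by simp
    finally show ?thesis using 3 by simp
  qed
qed

text \<open>
  Expanding \<open>[y, [a, [y, v]]]\<close> with \<open>a = x\<^sub>i\<close>, \<open>y = x\<^bsub>i+1\<^esub>\<close> and \<open>[a, v] = 0\<close> by the Jacobi
  identity reproduces the same term with the opposite sign, so it can be solved for.
\<close>

lemma bracket_w_next:
  assumes "1 \<le> i" "Suc i \<le> n - 1" "i + d \<le> n - 1"
  shows "x (Suc i) \<otimes>\<^bsub>L\<^esub> w d i \<in> span (root_vectors i)"
proof -
  note S = subspaceD[OF span_root_vectors_subspace[OF assms(1)]]
  let ?a = "x i" and ?y = "x (Suc i)"
  have cl: "?a \<in> carrier L" "?y \<in> carrier L" using assms by (simp_all add: x_closed)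
  \<comment> \<open>The relation for the pair (i + 1, i), whose minimum is \<open>i\<close>;
    reversing the inner bracket changes the sign.\<close>
  have yay: "?y \<otimes>\<^bsub>L\<^esub> (?a \<otimes>\<^bsub>L\<^esub> ?y) = (2 * b i) \<odot>\<^bsub>L\<^esub> ?y"
    using x_serre[of "Suc i" i] assms cl bracket_skew[of ?a ?y] smult_l_minus[of "2 * b i" ?y]
    by (simp add: prod_uminus prod_closed class_ring_simps)
  consider "d = 0" | "d = 1" | d' where "d = Suc (Suc d')"
    by (metis One_nat_def old.nat.exhaust)
  then show ?thesis
  proof cases
    case 1
    have "?y \<otimes>\<^bsub>L\<^esub> w d i = \<ominus>\<^bsub>L\<^esub> w 1 i" using 1 bracket_skew[OF cl(2,1)] by simp
    then show ?thesis
      using assms by (simp only:) (intro subspace_uminus[OF span_root_vectors_subspace] w_in_span; simp)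
  next
    case 2
    have "?y \<otimes>\<^bsub>L\<^esub> w d i = (2 * b i) \<odot>\<^bsub>L\<^esub> w 0 (Suc i)" using 2 yay by simp
    then show ?thesis using assms S(4) w_in_span[of i "Suc i" 0] by simp
  next
    case 3
    let ?v = "w d' (Suc (Suc i))"
    define y where "y = ?y \<otimes>\<^bsub>L\<^esub> ?v"
    have y_eq: "y = w (Suc d') (Suc i)" by (simp add: y_def)
    have v: "?v \<in> carrier L" and y: "y \<in> carrier L"
      using assms 3 cl by (simp_all add: y_def w_closed prod_closed)
    have av: "?a \<otimes>\<^bsub>L\<^esub> ?v = \<zero>\<^bsub>L\<^esub>" using assms 3 by (intro bracket_w_far_left) simp_all
    define z where "z = ?y \<otimes>\<^bsub>L\<^esub> (?a \<otimes>\<^bsub>L\<^esub> y)"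
    define q where "q = ?a \<otimes>\<^bsub>L\<^esub> (?y \<otimes>\<^bsub>L\<^esub> y)"
    have zq: "z \<in> carrier L" "q \<in> carrier L" using cl y by (simp_all add: z_def q_def prod_closed)
    have "?a \<otimes>\<^bsub>L\<^esub> y = (?a \<otimes>\<^bsub>L\<^esub> ?y) \<otimes>\<^bsub>L\<^esub> ?v"
      unfolding y_def using cl v av by (simp add: bracket_leibniz[of ?a ?y ?v] prod_zero prod_closed)
    then have "z = (2 * b i) \<odot>\<^bsub>L\<^esub> y \<oplus>\<^bsub>L\<^esub> (?a \<otimes>\<^bsub>L\<^esub> ?y) \<otimes>\<^bsub>L\<^esub> y"
      unfolding z_def using cl v prod_smult_left[of "2 * b i" ?y ?v]
      by (simp add: bracket_leibniz[of ?y "?a \<otimes>\<^bsub>L\<^esub> ?y" ?v] prod_closed yay flip: y_def)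
    also have "(?a \<otimes>\<^bsub>L\<^esub> ?y) \<otimes>\<^bsub>L\<^esub> y = q \<ominus>\<^bsub>L\<^esub> z"
      unfolding z_def q_def using cl y by (rule bracket_bracket)
    finally have "z \<oplus>\<^bsub>L\<^esub> z = ((2 * b i) \<odot>\<^bsub>L\<^esub> y \<oplus>\<^bsub>L\<^esub> (q \<ominus>\<^bsub>L\<^esub> z)) \<oplus>\<^bsub>L\<^esub> z" by simp
    then have zz: "z \<oplus>\<^bsub>L\<^esub> z = (2 * b i) \<odot>\<^bsub>L\<^esub> y \<oplus>\<^bsub>L\<^esub> q"
      using zq y by (simp add: a_minus_def M.a_assoc M.l_neg)
    have "y \<in> span (root_vectors i)" unfolding y_eq using assms 3 by (intro w_in_span) simp_all
    \<comment> \<open>The inner bracket is x_(i+1) with a root vector starting at i + 1. By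
      \<open>bracket_w_same\<close> it is nonzero only if that root vector has two letters, and then
      it is a multiple of x_(i+1).\<close>
    moreover have "q \<in> span (root_vectors i)"
    proof (cases "d' = 0")
      case True
      then have "?y \<otimes>\<^bsub>L\<^esub> y = (- 2 * b (Suc i)) \<odot>\<^bsub>L\<^esub> ?y"
        unfolding y_eq using bracket_w_same[of "Suc i" "Suc d'"] assms 3 by simp
      then have "q = (- 2 * b (Suc i)) \<odot>\<^bsub>L\<^esub> w 1 i"
        unfolding q_def using cl prod_smult_right[of "- 2 * b (Suc i)" ?a ?y] by simp
      then show ?thesis
        using S(4)[of "- 2 * b (Suc i)" "w 1 i"] w_in_span[of i i 1] assms by simp
    next
      case False
      then have "?y \<otimes>\<^bsub>L\<^esub> y = \<zero>\<^bsub>L\<^esub>"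
        unfolding y_eq using bracket_w_same[of "Suc i" "Suc d'"] assms 3 by simp
      then show ?thesis unfolding q_def using cl S(2) by (simp add: prod_zero)
    qed
    ultimately have "z \<oplus>\<^bsub>L\<^esub> z \<in> span (root_vectors i)"
      unfolding zz using S(3) S(4)[of "2 * b i" y] by simp
    \<comment> \<open>Here 2 has to be invertible.\<close>
    then have "(1 / 2) \<odot>\<^bsub>L\<^esub> (z \<oplus>\<^bsub>L\<^esub> z) \<in> span (root_vectors i)"
      using S(4)[of "1 / 2" "z \<oplus>\<^bsub>L\<^esub> z"] by simp
    also have "(1 / 2) \<odot>\<^bsub>L\<^esub> (z \<oplus>\<^bsub>L\<^esub> z) = z"
      using zq(1) smult_r_distr[of "1 / 2" z z] smult_l_distr[of "1 / 2" "1 / 2" z] smult_one[of z] by simp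
    finally show ?thesis using 3 by (simp add: z_def y_def)
  qed
qed

text \<open>For k > i + 1 the generator x_k commutes with x_i and moves past it to the shorter root
  vector starting at i + 1. By induction the result involves only left ends at least i + 1, and x_i
  either prolongs such a root vector or kills it. With a weaker bound, brackets of x_i with
  arbitrary root vectors would occur.\<close>

lemma bracket_w_right:
  assumes "1 \<le> i" "i < k" "k \<le> n - 1" "i + d \<le> n - 1"
  shows "x k \<otimes>\<^bsub>L\<^esub> w d i \<in> span (root_vectors i)"
  using assms
proof (induction "k - i" arbitrary: i d)
  case 0
  then show ?case by simp
next
  case (Suc e)
  note S = subspaceD[OF span_root_vectors_subspace[OF \<open>1 \<le> i\<close>]]
  show ?case
  proof (cases "k = Suc i")
    case True
    then show ?thesis using bracket_w_next Suc.prems by simp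
  next
    case False
    show ?thesis
    proof (cases d)
      case 0
      then show ?thesis using x_commute[of k i] False Suc.prems S(2) by simp
    next
      case (Suc d')
      have "x k \<otimes>\<^bsub>L\<^esub> w d i = x i \<otimes>\<^bsub>L\<^esub> (x k \<otimes>\<^bsub>L\<^esub> w d' (Suc i))"
        using Suc Suc.prems False by (simp add: bracket_commuting x_closed x_commute w_closed)
      also have "\<dots> \<in> span (root_vectors i)"
      proof (rule bracket_span[of "Suc i"])
        show "x k \<otimes>\<^bsub>L\<^esub> w d' (Suc i) \<in> span (root_vectors (Suc i))"
          using Suc.hyps(1)[of "Suc i" d'] Suc.hyps(2) Suc.prems Suc False by simp
        fix d j assume "Suc i \<le> j" "j + d \<le> n - 1"
        then show "x i \<otimes>\<^bsub>L\<^esub> w d j \<in> span (root_vectors i)"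
          using w_in_span[of i i "Suc d"] bracket_w_far_left[of i j d] \<open>1 \<le> i\<close> S(2)
          by (cases "j = Suc i") auto
      qed (use Suc.prems in \<open>simp_all add: span_root_vectors_subspace x_closed\<close>)
      finally show ?thesis .
    qed
  qed
qed

lemma bracket_w_in_span:
  assumes k: "k \<in> {1..n-1}" and i: "1 \<le> i" "i + d \<le> n - 1"
  shows "x k \<otimes>\<^bsub>L\<^esub> w d i \<in> span (root_vectors 1)"
proof -
  note S = subspaceD[OF span_root_vectors_subspace[OF order_refl]]
  consider "i < k" | "k = i" | "i = Suc k" | "k + 1 < i" by linarith
  then show ?thesis
  proof cases
    case 1
    then have "x k \<otimes>\<^bsub>L\<^esub> w d i \<in> span (root_vectors i)" using assms by (intro bracket_w_right) auto
    moreover have "span (root_vectors i) \<subseteq> span (root_vectors 1)"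
      using root_vectors_mono[OF i(1)] by (rule span_is_monotone)
    ultimately show ?thesis by blast
  next
    case 2
    then show ?thesis
      using bracket_w_same[OF i] S(2) S(4)[of "- 2 * b i" "w 0 i"] w_in_span[of 1 i 0] i by simp
  next
    case 3
    then show ?thesis using w_in_span[of 1 k "Suc d"] i k by simp
  next
    case 4
    then show ?thesis using bracket_w_far_left[of k i d] S(2) i k by simp
  qed
qed

lemma ad_stable_span:
  assumes "k \<in> {1..n-1}" "y \<in> span (root_vectors 1)"
  shows "x k \<otimes>\<^bsub>L\<^esub> y \<in> span (root_vectors 1)"
  by (rule bracket_span[OF order_refl span_root_vectors_subspace[OF order_refl]
        x_closed[OF assms(1)] bracket_w_in_span[OF assms(1)] assms(2)])

end

section \<open>The matrices \<open>u\<^sub>i\<close>\<close>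

lemma mat_mult_entry:
  assumes "A \<in> carrier_mat n n" "B \<in> carrier_mat n n" "r < n" "c < n"
  shows "(A * B) $$ (r, c) = (\<Sum>k<n. A $$ (r, k) * B $$ (k, c))"
  using assms by (simp add: scalar_prod_def atLeast0LessThan)

lemma trace_comm:
  fixes A B :: "'a::comm_semiring_0 mat"
  assumes "A \<in> carrier_mat n n" "B \<in> carrier_mat n n"
  shows "(\<Sum>i<n. (A * B) $$ (i, i)) = (\<Sum>i<n. (B * A) $$ (i, i))"
proof -
  have "(\<Sum>i<n. (A * B) $$ (i, i)) = (\<Sum>i<n. \<Sum>k<n. A $$ (i, k) * B $$ (k, i))"
    using assms by (intro sum.cong) (simp_all add: mat_mult_entry[of _ n] del: index_mult_mat)
  also have "\<dots> = (\<Sum>k<n. \<Sum>i<n. B $$ (k, i) * A $$ (i, k))"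
    by (subst sum.swap) (simp add: mult.commute)
  also have "\<dots> = (\<Sum>i<n. (B * A) $$ (i, i))"
    using assms by (intro sum.cong) (simp_all add: mat_mult_entry[of _ n] del: index_mult_mat)
  finally show ?thesis .
qed

lemma jacobi_mat:
  fixes A B C :: "'a::comm_ring_1 mat"
  assumes A: "A \<in> carrier_mat n n" and B: "B \<in> carrier_mat n n" and C: "C \<in> carrier_mat n n"
  shows "(A * (B * C - C * B) - (B * C - C * B) * A) + (B * (C * A - A * C) - (C * A - A * C) * B)
    + (C * (A * B - B * A) - (A * B - B * A) * C) = 0\<^sub>m n n"
proof -
  have expand: "X * (Y * Z - Z * Y) - (Y * Z - Z * Y) * X
      = (X * (Y * Z) - X * (Z * Y)) - (Y * (Z * X) - Z * (Y * X))"
    if "X \<in> carrier_mat n n" "Y \<in> carrier_mat n n" "Z \<in> carrier_mat n n" for X Y Z :: "'a mat"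
    using that by (simp add: mult_minus_distrib_mat[of _ n n _ n] minus_mult_distrib_mat[of _ n n _ _ n])
  have "X * (Y * Z) \<in> carrier_mat n n"
    if "X \<in> carrier_mat n n" "Y \<in> carrier_mat n n" "Z \<in> carrier_mat n n" for X Y Z :: "'a mat"
    using that by simp
  note cl = this[OF A B C] this[OF A C B] this[OF B A C] this[OF B C A] this[OF C A B] this[OF C B A]
  \<comment> \<open>The six letters stand for the products of \<open>A\<close>, \<open>B\<close>,
    \<open>C\<close> in all orders; each occurs twice with opposite signs.\<close>
  have "(P - Q - (R - S)) + (R - T - (U - Q)) + (U - S - (P - T)) = 0\<^sub>m n n"
    if "P \<in> carrier_mat n n" "Q \<in> carrier_mat n n" "R \<in> carrier_mat n n" "S \<in> carrier_mat n n"
      "T \<in> carrier_mat n n" "U \<in> carrier_mat n n" for P Q R S T U :: "'a mat"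
    using that by (intro eq_matI) auto
  then show ?thesis
    unfolding expand[OF A B C] expand[OF B C A] expand[OF C A B] using cl by blast
qed

lemma sl_mult: "A \<otimes>\<^bsub>sl n\<^esub> B = A * B - B * A"
  by (simp add: sl_def)

lemma lie_algebra_sl: "lie_algebra class_ring (sl n)"
proof -
  have trace: "(\<Sum>i<n. (A * B - B * A) $$ (i, i)) = 0"
    if "A \<in> carrier_mat n n" "B \<in> carrier_mat n n" for A B :: "complex mat"
    using that trace_comm[OF that] by (simp add: sum_subtractf del: index_mult_mat(1))
  have "vectorspace class_ring (sl n)"
  proof (rule vs_criteria)
    show "field (class_ring :: complex ring)" by (rule class_field)
    show "\<forall>v\<in>carrier (sl n). \<exists>w\<in>carrier (sl n). v \<oplus>\<^bsub>sl n\<^esub> w = \<zero>\<^bsub>sl n\<^esub>"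
    proof (rule ballI, rule bexI)
      fix A assume A: "A \<in> carrier (sl n)"
      then have "(\<Sum>i<n. (- A) $$ (i, i)) = (\<Sum>i<n. - A $$ (i, i))"
        by (intro sum.cong) (auto simp: sl_def)
      then show "- A \<in> carrier (sl n)" using A by (simp add: sl_def sum_negf)
      show "A \<oplus>\<^bsub>sl n\<^esub> - A = \<zero>\<^bsub>sl n\<^esub>" using A by (auto simp: sl_def intro!: eq_matI)
    qed
  qed (auto simp: sl_def sum.distrib algebra_simps simp flip: sum_distrib_left intro!: eq_matI)
  then show ?thesis
  proof (intro lie_algebra.intro nonassoc_algebra.intro nonassoc_algebra_axioms.intro lie_algebra_axioms.intro)
    fix x y z :: "complex mat" and c :: complex
    assume "x \<in> carrier (sl n)" "y \<in> carrier (sl n)"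
    then have x: "x \<in> carrier_mat n n" and y: "y \<in> carrier_mat n n" by (auto simp: sl_def)
    show "x \<otimes>\<^bsub>sl n\<^esub> y \<in> carrier (sl n)" using trace[OF x y] minus_carrier_mat[OF mult_carrier_mat[OF y x]]
      by (simp add: sl_def del: index_mult_mat(1))
    have scale: "c \<cdot>\<^sub>m (x * y - y * x) = c \<cdot>\<^sub>m (x * y) - c \<cdot>\<^sub>m (y * x)"
      using x y by (intro eq_matI) (auto simp: algebra_simps simp del: index_mult_mat(1))
    show "c \<odot>\<^bsub>sl n\<^esub> x \<otimes>\<^bsub>sl n\<^esub> y = c \<odot>\<^bsub>sl n\<^esub> (x \<otimes>\<^bsub>sl n\<^esub> y)"
      "x \<otimes>\<^bsub>sl n\<^esub> (c \<odot>\<^bsub>sl n\<^esub> y) = c \<odot>\<^bsub>sl n\<^esub> (x \<otimes>\<^bsub>sl n\<^esub> y)"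
      using x y scale
      by (simp_all add: sl_def mult_smult_distrib[of _ n n _ n] mult_smult_assoc_mat[of _ n n _ n])
    assume "z \<in> carrier (sl n)"
    then have z: "z \<in> carrier_mat n n" by (auto simp: sl_def)
    have minus: "(P + Q) - (R + S) = (P - R) + (Q - S)"
      if "P \<in> carrier_mat n n" "Q \<in> carrier_mat n n" "R \<in> carrier_mat n n" "S \<in> carrier_mat n n"
      for P Q R S :: "complex mat"
      using that by (intro eq_matI) auto
    show "(x \<oplus>\<^bsub>sl n\<^esub> y) \<otimes>\<^bsub>sl n\<^esub> z = x \<otimes>\<^bsub>sl n\<^esub> z \<oplus>\<^bsub>sl n\<^esub> y \<otimes>\<^bsub>sl n\<^esub> z"
      "z \<otimes>\<^bsub>sl n\<^esub> (x \<oplus>\<^bsub>sl n\<^esub> y) = z \<otimes>\<^bsub>sl n\<^esub> x \<oplus>\<^bsub>sl n\<^esub> z \<otimes>\<^bsub>sl n\<^esub> y"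
      using x y z by (simp_all add: sl_def add_mult_distrib_mat[of _ n n _ _ n] mult_add_distrib_mat[of _ n n _ n] minus)
    show "x \<otimes>\<^bsub>sl n\<^esub> (y \<otimes>\<^bsub>sl n\<^esub> z) \<oplus>\<^bsub>sl n\<^esub> y \<otimes>\<^bsub>sl n\<^esub> (z \<otimes>\<^bsub>sl n\<^esub> x)
        \<oplus>\<^bsub>sl n\<^esub> z \<otimes>\<^bsub>sl n\<^esub> (x \<otimes>\<^bsub>sl n\<^esub> y) = \<zero>\<^bsub>sl n\<^esub>"
      using jacobi_mat[OF x y z] by (simp add: sl_def)
  qed (auto simp: sl_def)
qed

section \<open>The rank-one matrices u_i and their relations\<close>

text \<open>The only nonzero row of \<open>u\<^sub>i\<close> is row \<open>i\<close>; so \<open>u\<^sub>i\<close> has rank one and \<open>u\<^sub>i X u\<^sub>i\<close> is a multiple of \<open>u\<^sub>i\<close>.\<close>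

definition sl_b_row :: "(nat \<Rightarrow> complex) \<Rightarrow> nat \<Rightarrow> nat \<Rightarrow> complex" where
  "sl_b_row b i c = (if c = i then 1 else if c + 2 = i then b (i - 1) else 0)"

lemma sl_b_gen_carrier: "sl_b_gen n b i \<in> carrier_mat n n"
  by (simp add: sl_b_gen_def chevalley_e_def chevalley_f_def matrix_unit_def)

text \<open>Indices count from 0: the 1 of E_(i,i+1) is in column i, and the coefficient of
  E_(i,i-1) is in column i - 2. For i = 1 the test \<open>c + 2 = i\<close> always fails, which is
  the convention f_0 = 0.\<close>

lemma sl_b_gen_entry:
  assumes "r < n" "c < n"
  shows "sl_b_gen n b i $$ (r, c) = (if r + 1 = i then sl_b_row b i c else 0)"
  using assms by (auto simp: sl_b_gen_def chevalley_e_def chevalley_f_def matrix_unit_def sl_b_row_def)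

lemma sl_b_gen_mult_entry:
  assumes "B \<in> carrier_mat n n" "r < n" "c < n"
  shows "(sl_b_gen n b i * B) $$ (r, c) = (if r + 1 = i then \<Sum>k<n. sl_b_row b i k * B $$ (k, c) else 0)"
    "i \<in> {1..n} \<Longrightarrow> (B * sl_b_gen n b i) $$ (r, c) = B $$ (r, i - 1) * sl_b_row b i c"
proof -
  show "(sl_b_gen n b i * B) $$ (r, c) = (if r + 1 = i then \<Sum>k<n. sl_b_row b i k * B $$ (k, c) else 0)"
    using assms by (simp add: mat_mult_entry[of _ n] sl_b_gen_carrier sl_b_gen_entry del: index_mult_mat(1))
  assume i: "i \<in> {1..n}"
  have "(B * sl_b_gen n b i) $$ (r, c) = (\<Sum>k<n. if k = i - 1 then B $$ (r, k) * sl_b_row b i c else 0)"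
    unfolding mat_mult_entry[OF assms(1) sl_b_gen_carrier assms(2,3)]
    using assms i by (intro sum.cong) (auto simp: sl_b_gen_entry)
  then show "(B * sl_b_gen n b i) $$ (r, c) = B $$ (r, i - 1) * sl_b_row b i c"
    using i by auto
qed

lemma sl_b_gen_mult_gen_entry:
  assumes "j \<in> {1..n}" "r < n" "c < n"
  shows "(sl_b_gen n b i * sl_b_gen n b j) $$ (r, c)
    = (if r + 1 = i then sl_b_row b i (j - 1) * sl_b_row b j c else 0)"
proof -
  have "j - 1 < n" using assms by auto
  with assms show ?thesis
    by (simp add: sl_b_gen_mult_entry(2)[OF sl_b_gen_carrier] sl_b_gen_entry del: index_mult_mat(1))
qed

text \<open>The product carries the factor \<open>sl_b_row b i (j - 1)\<close>, which can be nonzero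
  only for neighbouring indices. The case i = j yields u_i^2 = 0.\<close>

lemma sl_b_gen_mult_zero:
  assumes "i \<in> {1..n}" "j \<in> {1..n}" "\<bar>int i - int j\<bar> \<noteq> 1"
  shows "sl_b_gen n b i * sl_b_gen n b j = 0\<^sub>m n n"
proof (rule eq_matI)
  fix r c assume "r < dim_row (0\<^sub>m n n)" "c < dim_col (0\<^sub>m n n)"
  moreover have "sl_b_row b i (j - 1) = 0" using assms by (auto simp: sl_b_row_def)
  ultimately show "(sl_b_gen n b i * sl_b_gen n b j) $$ (r, c) = 0\<^sub>m n n $$ (r, c)"
    using assms by (simp add: sl_b_gen_mult_gen_entry del: index_mult_mat(1))
qed (use sl_b_gen_carrier in auto)

text \<open>With u_i = e_i r_i, a unit column times a row, the product regroups as e_i (r_i e_j)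
  (r_j e_i) r_i; the two inner pairings are the scalars.\<close>

lemma sl_b_gen_triple:
  assumes "i \<in> {1..n}" "j \<in> {1..n}"
  shows "sl_b_gen n b i * sl_b_gen n b j * sl_b_gen n b i
    = (sl_b_row b i (j - 1) * sl_b_row b j (i - 1)) \<cdot>\<^sub>m sl_b_gen n b i" (is "?A = ?B")
proof (rule eq_matI)
  have AB: "sl_b_gen n b i * sl_b_gen n b j \<in> carrier_mat n n"
    using sl_b_gen_carrier by (rule mult_carrier_mat) (rule sl_b_gen_carrier)
  show dim: "dim_row ?A = dim_row ?B" "dim_col ?A = dim_col ?B"
    using sl_b_gen_carrier[of n b i] by auto
  fix r c assume "r < dim_row ?B" "c < dim_col ?B"
  then have rc: "r < n" "c < n" using sl_b_gen_carrier[of n b i] by auto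
  moreover have "i - 1 < n" using assms by auto
  ultimately show "?A $$ (r, c) = ?B $$ (r, c)"
    using assms sl_b_gen_carrier[of n b i]
    by (simp add: sl_b_gen_mult_entry(2)[OF AB] sl_b_gen_mult_gen_entry sl_b_gen_entry del: index_mult_mat(1))
qed

lemma sl_b_gen_closed:
  assumes "i \<in> {1..n-1}"
  shows "sl_b_gen n b i \<in> carrier (sl n)"
proof -
  have "sl_b_gen n b i $$ (r, r) = 0" if "r < n" for r
    using that by (simp add: sl_b_gen_entry sl_b_row_def)
  then show ?thesis using sl_b_gen_carrier by (simp add: sl_def)
qed

lemma sl_b_gen_commute:
  assumes "i \<in> {1..n}" "j \<in> {1..n}" "\<bar>int i - int j\<bar> > 1"
  shows "sl_b_gen n b i \<otimes>\<^bsub>sl n\<^esub> sl_b_gen n b j = \<zero>\<^bsub>sl n\<^esub>"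
proof -
  have "\<bar>int i - int j\<bar> \<noteq> 1" "\<bar>int j - int i\<bar> \<noteq> 1" using assms by auto
  then have "sl_b_gen n b i * sl_b_gen n b j = 0\<^sub>m n n" "sl_b_gen n b j * sl_b_gen n b i = 0\<^sub>m n n"
    using assms by (auto intro!: sl_b_gen_mult_zero)
  then show ?thesis by (simp add: sl_def)
qed

text \<open>The double commutator is u^2 v - 2 u v u + v u^2, and the outer terms vanish since u^2 =
  0.\<close>

lemma sl_b_gen_serre:
  assumes "i \<in> {1..n}" "j \<in> {1..n}" "\<bar>int i - int j\<bar> = 1"
  shows "sl_b_gen n b i \<otimes>\<^bsub>sl n\<^esub> (sl_b_gen n b i \<otimes>\<^bsub>sl n\<^esub> sl_b_gen n b j)
    = (- 2 * b (min i j)) \<odot>\<^bsub>sl n\<^esub> sl_b_gen n b i"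
proof -
  let ?u = "sl_b_gen n b i" and ?v = "sl_b_gen n b j"
  have u: "?u \<in> carrier_mat n n" and v: "?v \<in> carrier_mat n n" by (rule sl_b_gen_carrier)+
  have uu: "?u * ?u = 0\<^sub>m n n" using assms by (intro sl_b_gen_mult_zero) auto
  let ?t = "?u * ?v * ?u"
  have t: "?t \<in> carrier_mat n n" using u v by simp
  have double: "(0\<^sub>m n n - T) - (T - 0\<^sub>m n n) = (- 2) \<cdot>\<^sub>m T" if "T \<in> carrier_mat n n" for T :: "complex mat"
    using that by (intro eq_matI) auto
  \<comment> \<open>The row with the smaller index contributes its entry 1, the other row its entry
    \<open>b (min i j)\<close>.\<close>
  have c: "sl_b_row b i (j - 1) * sl_b_row b j (i - 1) = b (min i j)"
  proof (cases "j = Suc i")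
    case True
    then show ?thesis using assms by (simp add: sl_b_row_def)
  next
    case False
    then have "i = Suc j" using assms by auto
    then show ?thesis using assms by (simp add: sl_b_row_def)
  qed
  have "?u * (?u * ?v - ?v * ?u) - (?u * ?v - ?v * ?u) * ?u
      = (?u * (?u * ?v) - ?u * (?v * ?u)) - (?u * ?v * ?u - ?v * ?u * ?u)"
    using u v by (simp add: mult_minus_distrib_mat[of _ n n _ n] minus_mult_distrib_mat[of _ n n _ _ n])
  also have "?u * (?u * ?v) = 0\<^sub>m n n" using u v uu by (simp flip: assoc_mult_mat[of _ n n _ n _ n])
  also have "?v * ?u * ?u = 0\<^sub>m n n" using u v uu by (simp add: assoc_mult_mat[of _ n n _ n _ n])
  also have "?u * (?v * ?u) = ?t" using u v by (simp add: assoc_mult_mat[of _ n n _ n _ n])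
  also have "(0\<^sub>m n n - ?t) - (?t - 0\<^sub>m n n) = (- 2) \<cdot>\<^sub>m ?t"
    by (rule double[OF t])
  also have "\<dots> = (- 2 * b (min i j)) \<cdot>\<^sub>m ?u"
    unfolding sl_b_gen_triple[OF assms(1,2)] c using u by (intro eq_matI) auto
  finally show ?thesis by (simp add: sl_def)
qed

section \<open>Leading terms of iterated brackets\<close>

lemma root_vector_carrier: "root_vector (sl n) (sl_b_gen n b) d i \<in> carrier_mat n n"
proof (induction d arbitrary: i)
  case (Suc d)
  show ?case
    unfolding root_vector.simps sl_mult using Suc[of "Suc i"] sl_b_gen_carrier[of n b i]
    by (intro minus_carrier_mat mult_carrier_mat)
qed (simp add: sl_b_gen_carrier)

text \<open>Entries are indexed from 0, so the position \<open>(i - 1, i + d)\<close> is that of \<open>E\<^bsub>i,i+d+1\<^esub>\<close>.\<close>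

lemma root_vector_leading_term:
  assumes "1 \<le> i" "i + d \<le> n - 1" "c < n" "r + d + 1 \<le> c"
  shows "root_vector (sl n) (sl_b_gen n b) d i $$ (r, c) = (if r + 1 = i \<and> c = i + d then 1 else 0)"
  using assms
\<comment> \<open>The claim covers the leading diagonal and everything above it. Entries further
  down, where the b_j interfere, remain unspecified and never enter the induction.\<close>
proof (induction d arbitrary: i r c)
  case 0
  then show ?case by (auto simp: sl_b_gen_entry sl_b_row_def)
next
  case (Suc d)
  let ?W = "root_vector (sl n) (sl_b_gen n b) d (Suc i)" and ?u = "sl_b_gen n b i"
  have rc: "r < n" "c < n" and i: "i \<in> {1..n}" using Suc.prems by auto
  have "(?W * ?u) $$ (r, c) = ?W $$ (r, i - 1) * sl_b_row b i c"
    by (rule sl_b_gen_mult_entry(2)[OF root_vector_carrier rc i])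
  \<comment> \<open>If the row factor is nonzero, then c is i or i - 2, and column i - 1 is still in
    the range of the induction hypothesis in row r. The only nonzero entry of \<open>?W\<close> in
    that range is in column i + d + 1.\<close>
  also have "\<dots> = 0"
  proof (cases "c = i \<or> c + 2 = i")
    case True
    then show ?thesis using Suc.prems by (subst Suc.IH) auto
  qed (simp add: sl_b_row_def)
  finally have right: "(?W * ?u) $$ (r, c) = 0" .
  have left: "(?u * ?W) $$ (r, c) = (if r + 1 = i \<and> c = i + Suc d then 1 else 0)"
  proof (cases "r + 1 = i")
    case True
    \<comment> \<open>Row \<open>i\<close> of u_i has entries in columns i and i - 2 only. The first
      meets the leading 1 of \<open>?W\<close>; the second, carrying b, meets a row where
      \<open>?W\<close> vanishes in column \<open>c\<close>.\<close>
    have "sl_b_row b i k * ?W $$ (k, c) = (if k = i then if c = i + Suc d then 1 else 0 else 0)" if "k < n" for k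
      using Suc.IH[of "Suc i" c k] Suc.prems True by (auto simp: sl_b_row_def)
    then have "(\<Sum>k<n. sl_b_row b i k * ?W $$ (k, c)) = (if c = i + Suc d then 1 else 0)"
      using Suc.prems by simp
    then show ?thesis using sl_b_gen_mult_entry(1)[OF root_vector_carrier rc] True by simp
  next
    case False
    then show ?thesis using sl_b_gen_mult_entry(1)[OF root_vector_carrier rc] by simp
  qed
  have "root_vector (sl n) (sl_b_gen n b) (Suc d) i = ?u * ?W - ?W * ?u" by (simp add: sl_mult)
  then show ?case
    using left right rc root_vector_carrier[of n b d "Suc i"] sl_b_gen_carrier[of n b i]
    by (simp del: index_mult_mat(1))
qed

section \<open>The presentation\<close>

lemma sl_b_simps:
  "add (sl_b n b) = add (sl n)" "zero (sl_b n b) = zero (sl n)" "mult (sl_b n b) = mult (sl n)"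
  "smult (sl_b n b) = smult (sl n)"
  "carrier (sl_b n b) = generated_subalgebra class_ring (sl n) (sl_b_gen n b ` {1..n-1})"
  by (simp_all add: sl_b_def)

lemma subalgebra_sl_b:
  "subalgebra class_ring (carrier (sl_b n b)) (sl n)"
  "sl_b_gen n b ` {1..n-1} \<subseteq> carrier (sl_b n b)"
  "\<And>H. subalgebra class_ring H (sl n) \<Longrightarrow> sl_b_gen n b ` {1..n-1} \<subseteq> H \<Longrightarrow> carrier (sl_b n b) \<subseteq> H"
proof -
  interpret sl: lie_algebra class_ring "sl n" by (rule lie_algebra_sl)
  have gens: "sl_b_gen n b ` {1..n-1} \<subseteq> carrier (sl n)" using sl_b_gen_closed by blast
  note gen = subalgebra_generated_subalgebra[OF subalgebra_carrier[OF sl.nonassoc_algebra_axioms] gens]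
  show "subalgebra class_ring (carrier (sl_b n b)) (sl n)"
    "sl_b_gen n b ` {1..n-1} \<subseteq> carrier (sl_b n b)"
    "\<And>H. subalgebra class_ring H (sl n) \<Longrightarrow> sl_b_gen n b ` {1..n-1} \<subseteq> H \<Longrightarrow> carrier (sl_b n b) \<subseteq> H"
    unfolding sl_b_simps by (rule gen; assumption?)+
qed

lemma sl_b_subset: "carrier (sl_b n b) \<subseteq> carrier (sl n)"
  using subalgebra_sl_b(1) unfolding subalgebra_def by (blast dest: subspaceD(1))

lemma lie_algebra_sl_b: "lie_algebra class_ring (sl_b n b)"
proof -
  have "sl_b n b = (sl n)\<lparr>carrier := carrier (sl_b n b)\<rparr>" by (simp add: sl_b_def)
  then show ?thesis using lie_algebra_subalgebra[OF lie_algebra_sl subalgebra_sl_b(1)] by metis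
qed

text \<open>\<open>E\<close> will be the functional that reads one entry of the image matrix; the
  lemma passes from sums in a record to ordinary sums of scalars.\<close>

lemma (in vectorspace) additive_finsum:
  fixes E :: "'c \<Rightarrow> 'k::comm_ring"
  assumes "finite T" "f \<in> T \<rightarrow> carrier V" "E \<zero>\<^bsub>V\<^esub> = 0"
    and add: "\<And>y z. y \<in> carrier V \<Longrightarrow> z \<in> carrier V \<Longrightarrow> E (y \<oplus>\<^bsub>V\<^esub> z) = E y + E z"
  shows "E (\<Oplus>\<^bsub>V\<^esub>v\<in>T. f v) = (\<Sum>v\<in>T. E (f v))"
  using assms(1,2)
proof (induction T rule: finite_induct)
  case (insert v T)
  then show ?case by (simp add: add M.finsum_closed Pi_def)
qed (simp add: assms(3))

context
  fixes n :: nat and b :: "nat \<Rightarrow> complex"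
  notes [simp del] = One_nat_def
begin

lemma sl_b_relationsE:
  assumes "(p, q) \<in> sl_b_relations n b"
  obtains (commute) i j where "i \<in> {1..n-1}" "j \<in> {1..n-1}" "\<bar>int i - int j\<bar> > 1"
      "p = free_lie_gen {1..n-1} i \<otimes>\<^bsub>free_lie {1..n-1}\<^esub> free_lie_gen {1..n-1} j" "q = \<zero>\<^bsub>free_lie {1..n-1}\<^esub>"
  | (serre) i j where "i \<in> {1..n-1}" "j \<in> {1..n-1}" "\<bar>int i - int j\<bar> = 1"
      "p = free_lie_gen {1..n-1} i \<otimes>\<^bsub>free_lie {1..n-1}\<^esub>
        (free_lie_gen {1..n-1} i \<otimes>\<^bsub>free_lie {1..n-1}\<^esub> free_lie_gen {1..n-1} j)"
      "q = (- 2 * b (min i j)) \<odot>\<^bsub>free_lie {1..n-1}\<^esub> free_lie_gen {1..n-1} i"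
  using assms unfolding sl_b_relations_def Let_def by blast

lemma sl_b_presentation: "lie_presentation {1..n-1} (sl_b_relations n b)"
proof (rule lie_presentation.intro)
  let ?X = "{1..n-1}"
  interpret F: lie_algebra class_ring "free_lie ?X :: (complex, (nat magma \<Rightarrow>\<^sub>0 complex) set) module"
    by (rule lie_algebra_free_lie)
  note gen = free_lie_gen_closed[where X = ?X]
  show "sl_b_relations n b \<subseteq> carrier (free_lie ?X) \<times> carrier (free_lie ?X)"
  proof (rule subrelI)
    fix p q assume "(p, q) \<in> sl_b_relations n b"
    then show "(p, q) \<in> carrier (free_lie ?X) \<times> carrier (free_lie ?X)"
    proof (cases rule: sl_b_relationsE)
      case (commute i j)
      then show ?thesis using F.prod_closed[OF gen gen, of i j] by simp
    next
      case (serre i j)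
      then show ?thesis
        using F.prod_closed[OF gen F.prod_closed[OF gen gen], of i i j]
          F.smult_closed[OF _ gen, of "- 2 * b (min i j)" i] by simp
    qed
  qed
qed

interpretation lie_presentation "{1..n-1}" "sl_b_relations n b"
  by (rule sl_b_presentation)

lemma presented_sl_b_relators: "sl_b_relators P n b gen"
proof (intro sl_b_relators.intro sl_b_relators_axioms.intro P.lie_algebra_axioms)
  note hom = algebra_homD[OF proj_hom]
  let ?x = "free_lie_gen {1..n-1} :: nat \<Rightarrow> (nat magma \<Rightarrow>\<^sub>0 complex) set"
  note x = free_lie_gen_closed[where X = "{1..n-1}" and ?'k = complex]
  fix i j assume i: "i \<in> {1..n-1}"
  show "gen i \<in> carrier P" using i by (rule gen_closed)
  assume j: "j \<in> {1..n-1}"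
  {
    assume "\<bar>int i - int j\<bar> > 1"
    then have "(?x i \<otimes>\<^bsub>F\<^esub> ?x j, \<zero>\<^bsub>F\<^esub>) \<in> sl_b_relations n b"
      using i j unfolding sl_b_relations_def Let_def by blast
    from proj_eq[OF this] show "gen i \<otimes>\<^bsub>P\<^esub> gen j = \<zero>\<^bsub>P\<^esub>"
      using hom(4)[OF x[OF i] x[OF j]] algebra_hom_zero[OF proj_hom F.vectorspace_axioms P.vectorspace_axioms]
      by (simp add: proj_gen)
  next
    assume "\<bar>int i - int j\<bar> = 1"
    then have "(?x i \<otimes>\<^bsub>F\<^esub> (?x i \<otimes>\<^bsub>F\<^esub> ?x j), (- 2 * b (min i j)) \<odot>\<^bsub>F\<^esub> ?x i) \<in> sl_b_relations n b"
      using i j unfolding sl_b_relations_def Let_def by blast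
    from proj_eq[OF this] show "gen i \<otimes>\<^bsub>P\<^esub> (gen i \<otimes>\<^bsub>P\<^esub> gen j) = (- 2 * b (min i j)) \<odot>\<^bsub>P\<^esub> gen i"
      using hom(4)[OF x[OF i] x[OF j]] hom(4)[OF x[OF i] F.prod_closed[OF x[OF i] x[OF j]]]
        hom(3)[OF _ x[OF i], of "- 2 * b (min i j)"]
      by (simp add: proj_gen)
  }
qed

interpretation R: sl_b_relators P n b gen
  by (rule presented_sl_b_relators)

lemma presented_sl_b_span: "carrier P = P.span (R.root_vectors 1)"
proof (rule subspace_ad_stable_eq_carrier[symmetric])
  show "VectorSpace.subspace class_ring (P.span (R.root_vectors 1)) P"
    by (rule R.span_root_vectors_subspace) simp
  show "gen x \<in> P.span (R.root_vectors 1)" if "x \<in> {1..n-1}" for x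
    using R.w_in_span[of 1 x 0] that by simp
qed (rule R.ad_stable_span)

text \<open>
  The leading terms of the images of the root vectors are distinct matrix units, so the coefficient
  of a root vector of maximal length in a linear combination can be read off from one matrix entry.
\<close>

lemma presented_sl_b_injective:
  assumes g: "g \<in> algebra_hom class_ring P (sl_b n b)"
    and gu: "\<And>i. i \<in> {1..n-1} \<Longrightarrow> g (gen i) = sl_b_gen n b i"
    and y: "y \<in> carrier P" and gy: "g y = \<zero>\<^bsub>sl_b n b\<^esub>"
  shows "y = \<zero>\<^bsub>P\<^esub>"
proof -
  interpret L: lie_algebra class_ring "sl_b n b" by (rule lie_algebra_sl_b)
  note gD = algebra_homD[OF g]
  have g0: "g \<zero>\<^bsub>P\<^esub> = \<zero>\<^bsub>sl_b n b\<^esub>"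
    by (rule algebra_hom_zero[OF g P.vectorspace_axioms L.vectorspace_axioms])
  have gw: "g (R.w d i) = root_vector (sl n) (sl_b_gen n b) d i" if "1 \<le> i" "i + d \<le> n - 1" for d i
    using that
  proof (induction d arbitrary: i)
    case (Suc d)
    then show ?case using gD(4)[of "gen i" "R.w d (Suc i)"]
      by (simp add: gu R.x_closed R.w_closed sl_b_simps)
  qed (simp add: gu)
  let ?T = "R.root_vectors 1"
  have T: "finite ?T" "?T \<subseteq> carrier P" by (simp_all add: R.finite_root_vectors R.root_vectors_closed)
  obtain a where a: "y = P.lincomb a ?T"
    using P.finite_in_span[OF T] y unfolding presented_sl_b_span by metis
  \<comment> \<open>Different index pairs have not been shown to give different elements, so one
    pair is chosen for each element of \<open>?T\<close>. Conversely, the chosen pair determines the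
    element, which identifies \<open>v0\<close> below.\<close>
  have "\<forall>v\<in>?T. \<exists>d i. v = R.w d i \<and> 1 \<le> i \<and> i + d \<le> n - 1"
    by (auto simp: R.root_vectors_def)
  then obtain D I where DI: "\<And>v. v \<in> ?T \<Longrightarrow> v = R.w (D v) (I v)"
    "\<And>v. v \<in> ?T \<Longrightarrow> 1 \<le> I v" "\<And>v. v \<in> ?T \<Longrightarrow> I v + D v \<le> n - 1"
    by metis
  have "a v = 0" if "v \<in> ?T" for v
  proof (rule ccontr)
    assume "a v \<noteq> 0"
    define B where "B = {v \<in> ?T. a v \<noteq> 0}"
    have B: "finite B" "B \<noteq> {}" using T that \<open>a v \<noteq> 0\<close> by (auto simp: B_def)
    obtain v0 where v0: "v0 \<in> B" and max: "\<And>v. v \<in> B \<Longrightarrow> D v \<le> D v0"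
      using Max_in[of "D ` B"] Max_ge[of "D ` B"] B by fastforce
    \<comment> \<open>The leading position of the image of \<open>v0\<close>: row and column of
      E_(i,i+d+1), counted from 0.\<close>
    define r c where "r = I v0 - 1" and "c = I v0 + D v0"
    have v0T: "v0 \<in> ?T" using v0 by (simp add: B_def)
    have rc: "r < n" "c < n" using DI(2,3)[OF v0T] by (auto simp: r_def c_def)
    define E where "E z = g z $$ (r, c)" for z
    have g_mat: "g z \<in> carrier_mat n n" if "z \<in> carrier P" for z
      using gD(1)[OF that] sl_b_subset[of n b] by (auto simp: sl_def)
    have E_add: "E (z \<oplus>\<^bsub>P\<^esub> z') = E z + E z'" if "z \<in> carrier P" "z' \<in> carrier P" for z z'
      using that rc g_mat[of z] g_mat[of z'] by (simp add: E_def gD sl_b_simps) (simp add: sl_def)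
    have E_smult: "E (k \<odot>\<^bsub>P\<^esub> z) = k * E z" if "z \<in> carrier P" for k z
      using that rc g_mat[of z] gD(3)[of k z] by (simp add: E_def sl_b_simps) (simp add: sl_def)
    have E0: "E \<zero>\<^bsub>P\<^esub> = 0" using rc by (simp add: E_def g0 sl_b_simps) (simp add: sl_def)
    \<comment> \<open>Root vectors longer than \<open>v0\<close> have coefficient zero. For the
      others D v <= D v0 puts the position (r, c) on or above their leading diagonal, where the
      entry is known.\<close>
    have summand: "a v * E v = (if v = v0 then a v0 else 0)" if "v \<in> ?T" for v
    proof (cases "a v = 0")
      case False
      then have le: "D v \<le> D v0" using that max by (simp add: B_def)
      have "E v = root_vector (sl n) (sl_b_gen n b) (D v) (I v) $$ (r, c)"
        using DI(1)[OF that] gw[of "I v" "D v"] DI(2,3)[OF that] by (simp add: E_def)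
      also have "\<dots> = (if r + 1 = I v \<and> c = I v + D v then 1 else 0)"
        using DI(2,3)[OF that] DI(2)[OF v0T] rc le
        by (intro root_vector_leading_term) (auto simp: r_def c_def)
      also have "r + 1 = I v \<and> c = I v + D v \<longleftrightarrow> v = v0"
        using DI(1)[OF that] DI(1,2)[OF v0T] by (auto simp: r_def c_def)
      finally show ?thesis by simp
    qed (use v0 in \<open>auto simp: B_def\<close>)
    have closed: "a v \<odot>\<^bsub>P\<^esub> v \<in> carrier P" if "v \<in> ?T" for v
      using that T(2) by auto
    have "E y = (\<Sum>v\<in>?T. E (a v \<odot>\<^bsub>P\<^esub> v))"
      unfolding a P.lincomb_def using T closed by (intro P.additive_finsum E0 E_add) auto
    also have "\<dots> = (\<Sum>v\<in>?T. if v = v0 then a v0 else 0)"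
      using T(2) by (intro sum.cong refl trans[OF E_smult summand]) auto
    also have "\<dots> = a v0" using T(1) v0T by simp
    also have "E y = 0" using gy g0 E0 by (simp add: E_def)
    finally show False using v0 by (simp add: B_def)
  qed
  then have "y = (\<Oplus>\<^bsub>P\<^esub>v\<in>?T. \<zero>\<^bsub>P\<^esub>)"
    unfolding a P.lincomb_def using T(2) P.smult_l_null
    by (intro P.M.finsum_cong') auto
  then show ?thesis by simp
qed

lemma sl_b_has_presentation:
  "has_lie_presentation (sl_b n b) {1..n-1} (sl_b_gen n b) (sl_b_relations n b)"
proof (rule has_lie_presentationI)
  show "lie_algebra class_ring (sl_b n b)" by (rule lie_algebra_sl_b)
  then interpret L: lie_algebra class_ring "sl_b n b" .
  show u: "sl_b_gen n b \<in> {1..n-1} \<rightarrow> carrier (sl_b n b)" using subalgebra_sl_b(2) by blast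
  show "f p = f q"
    if f: "f \<in> algebra_hom class_ring F (sl_b n b)"
      and fu: "\<And>i. i \<in> {1..n-1} \<Longrightarrow> f (free_lie_gen {1..n-1} i) = sl_b_gen n b i"
      and pq: "(p, q) \<in> sl_b_relations n b" for f p q
  proof -
    note hom = algebra_homD[OF f]
    note x = free_lie_gen_closed[where X = "{1..n-1}" and ?'k = complex]
    have le: "i \<in> {1..n}" if "i \<in> {1..n-1}" for i using that by auto
    show ?thesis using pq
    proof (cases rule: sl_b_relationsE)
      case (commute i j)
      then show ?thesis
        using hom(4)[OF x x, of i j] algebra_hom_zero[OF f F.vectorspace_axioms L.vectorspace_axioms]
          sl_b_gen_commute[OF le le, of i j b]
        by (simp add: fu sl_b_simps)
    next
      case (serre i j)
      then show ?thesis
        using hom(4)[OF x x, of i j] hom(4)[OF x F.prod_closed[OF x x], of i i j]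
          hom(3)[OF _ x, of "- 2 * b (min i j)" i] sl_b_gen_serre[OF le le, of i j b]
        by (simp add: fu sl_b_simps)
    qed
  qed
  show "carrier (sl_b n b) \<subseteq> H"
    if H: "subalgebra class_ring H (sl_b n b)" and gens: "sl_b_gen n b ` {1..n-1} \<subseteq> H" for H
  \<comment> \<open>Minimality of the generated subalgebra concerns subalgebras of
    \<open>sl n\<close>, so \<open>H\<close>, given inside \<open>sl_b n b\<close>, is first
    recognised as one of these.\<close>
  proof (rule subalgebra_sl_b(3)[OF _ gens])
    have "VectorSpace.subspace class_ring H (sl_b n b)" using H by (simp add: subalgebra_def)
    note HD = subspaceD[OF this]
    interpret sl: lie_algebra class_ring "sl n" by (rule lie_algebra_sl)
    have "H \<subseteq> carrier (sl n)" using HD(1) sl_b_subset by blast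
    then have "VectorSpace.subspace class_ring H (sl n)"
      using HD(2-4) unfolding sl_b_simps by (intro subspaceI sl.vectorspace_axioms)
    then show "subalgebra class_ring H (sl n)" using H by (simp add: subalgebra_def sl_b_simps)
  qed
qed (rule presented_sl_b_injective)

end

theorem theorem1p5:
  fixes n :: nat and b :: "nat \<Rightarrow> complex"
  assumes "n \<ge> 2"
  shows "has_lie_presentation (sl_b n b) {1..n-1} (sl_b_gen n b) (sl_b_relations n b)"
  by (rule sl_b_has_presentation)

end
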